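(* Let $n,N\ge 1$ be integers, let $\boldsymbol\alpha=(\alpha_1,\dots,\alpha_n)$, $\boldsymbol\beta=(\beta_1,\dots,\beta_n)$ satisfy $0<\alpha_k,\beta_k<1$ for $k=1,\dots,n$ and $0<|\beta|<1$, with the $\alpha_k$ pairwise distinct, and let $i\in\{1,2\}$ be a type. Let $\lambda_1,\dots,\lambda_n$ be the roots of the characteristic equation $\det(\lambda I_n-F^{(i)})=0$, and let $\boldsymbol\eta$ be the type-$i$ reversible probabilities (all defined in the context). By the knowledge of the degree one left eigenvectors $$P_{\boldsymbol e_j}(\boldsymbol x;\boldsymbol u)=1-\frac1N\sum_{k=1}^nu_{kj}x_k,\qquad j=1,\dots,n,$$ which satisfy $$\sum_{\boldsymbol x\in\mathcal X}K_n^{(i)}(\boldsymbol x,\boldsymbol y;N,\boldsymbol\alpha,\boldsymbol\beta)P_{\boldsymbol e_j}(\boldsymbol x;\boldsymbol u)=\lambda_jP_{\boldsymbol e_j}(\boldsymbol y;\boldsymbol u)\quad\text{for all }\boldsymbol y\in\mathcal X,\qquad j=1,\dots,n,$$ the system parameters $\{u_{kj}\}$ are completely identified: for $k,j=1,\dots,n$, $$u_{kj}=\frac{\alpha_k(\lambda_j-1)}{\lambda_j-\alpha_k}\ \text{ (type } i=1),\qquad u_{kj}=\frac{\lambda_j-1}{\lambda_j-\alpha_k}\ \text{ (type } i=2),$$ and each eigenvalue $\lambda_j$ satisfies the sum rule $$\sum_{k=1}^n\frac{\alpha_k\beta_k}{\lambda_j-\alpha_k}=-1\ \text{ (type } i=1),\qquad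 \sum_{k=1}^n\frac{\beta_k}{\lambda_j-\alpha_k}=-1\ \text{ (type } i=2),$$ which follows from $\sum_{k=1}^n\beta_ku_{kj}=1-\lambda_j$. As the degree one left eigenvectors, multiplied by $\sqrt{W_n(\boldsymbol x;N,\boldsymbol\eta)}$, are eigenvectors of the real symmetric matrix $\mathcal T^{(i)}$ defined in the context, they are orthogonal to each other and to $1=P_{\boldsymbol 0}(\boldsymbol x;\boldsymbol u)$: $$\sum_{\boldsymbol x\in\mathcal X}W_n(\boldsymbol x;N,\boldsymbol\eta)P_{\boldsymbol e_j}(\boldsymbol x;\boldsymbol u)=0\quad(j=1,\dots,n),\qquad \sum_{\boldsymbol x\in\mathcal X}W_n(\boldsymbol x;N,\boldsymbol\eta)P_{\boldsymbol e_j}(\boldsymbol x;\boldsymbol u)P_{\boldsymbol e_l}(\boldsymbol x;\boldsymbol u)=0\quad(j\ne l,\ j,l=1,\dots,n).$$ These are the so-called orthogonality conditions. Furthermore, the system parameters $\{u_{kj}\}$ are irrational functions of the original system parameters $\{\alpha_k\}$ and $\{\beta_k\}$.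
   Context: Notation: for $\boldsymbol x=(x_1,\dots,x_n)$, $|x|=\sum_{k=1}^n x_k$ (similarly $|\beta|=\sum_k\beta_k$). $\mathcal X=\{\boldsymbol x\in\mathbb N_0^n: |x|\le N\}$. $\boldsymbol e_j$ is the $j$-th unit vector. Distributions: $W_1(x;y,\alpha)=\binom{y}{x}\alpha^x(1-\alpha)^{y-x}$ for integers $0\le x\le y$, and $0$ otherwise. For an integer $M\ge0$ and a probability vector parameter $\boldsymbol\beta$ (likewise for $\boldsymbol\eta$), $$W_n(\boldsymbol x;M,\boldsymbol\beta)=\frac{M!}{x_1!\cdots x_n!\,(M-|x|)!}\,(1-|\beta|)^{M-|x|}\prod_{k=1}^n\beta_k^{x_k}$$ if all $x_k\ge0$ and $|x|\le M$, and $0$ otherwise. Markov chain operators (transition from $\boldsymbol y$ to $\boldsymbol x$, $\boldsymbol x,\boldsymbol y\in\mathcal X$): $$K_n^{(1)}(\boldsymbol x,\boldsymbol y;N,\boldsymbol\alpha,\boldsymbol\beta)=\sum_{\boldsymbol z\in\mathcal X}W_n(\boldsymbol x-\boldsymbol z;N-|z|,\boldsymbol\beta)\prod_{k=1}^nW_1(z_k;y_k,\alpha_k),$$ $$K_n^{(2)}(\boldsymbol x,\boldsymbol y;N,\boldsymbol\alpha,\boldsymbol\beta)=\sum_{\boldsymbol z\in\mathcal X}W_n(\boldsymbol x-\boldsymbol z;N-|y|,\boldsymbol\beta)\prod_{k=1}^nW_1(z_k;y_k,\alpha_k).$$ Characteristic matrices ($k,j=1,\dots,n$): $F^{(1)}_{kj}=-\alpha_k\beta_j+\alpha_k\delta_{kj}$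 and $F^{(2)}_{kj}=-\beta_j+\alpha_k\delta_{kj}$. The $n$ roots $\lambda_1,\dots,\lambda_n$ of $\det(\lambda I_n-F^{(i)})=0$ are listed in some fixed order. Reversible probabilities: $\eta_k=\dfrac{\beta_k}{1-\alpha_k}\dfrac1{D_n}$, where $D_n=1+\sum_{l=1}^n\dfrac{\alpha_l\beta_l}{1-\alpha_l}$ for type 1 and $D_n=1+\sum_{l=1}^n\dfrac{\beta_l}{1-\alpha_l}$ for type 2. With these, $K_n^{(i)}(\boldsymbol x,\boldsymbol y)W_n(\boldsymbol y;N,\boldsymbol\eta)=K_n^{(i)}(\boldsymbol y,\boldsymbol x)W_n(\boldsymbol x;N,\boldsymbol\eta)$, so that the matrix $$\mathcal T^{(i)}(\boldsymbol x,\boldsymbol y)=\frac{1}{\sqrt{W_n(\boldsymbol x;N,\boldsymbol\eta)}}\,K_n^{(i)}(\boldsymbol x,\boldsymbol y;N,\boldsymbol\alpha,\boldsymbol\beta)\,\sqrt{W_n(\boldsymbol y;N,\boldsymbol\eta)}$$ is real symmetric.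
   Formalization: The irrationality of the system parameters is stated only for n ≥ 2; for n = 1 it is false, since the single root is α(1−β) (type 1) or α−β (type 2), so u is a rational function of α and β. All other claims are for all n ≥ 1. *)

theory Defs
  imports "HOL-Analysis.Analysis"
begin

text \<open>
  The dimension \<open>n\<close> is \<open>CARD('n)\<close> for a finite index type \<open>'n\<close>, so \<open>n \<ge> 1\<close> is automatic.
  States are integer vectors, because the multinomial distribution is evaluated at differences
  \<open>x - z\<close> that may have negative entries.
\<close>

datatype chain_type = Type1 | Type2

definition vsum :: "'a::comm_monoid_add ^ 'n \<Rightarrow> 'a" where
  "vsum x = (\<Sum>k\<in>UNIV. x $ k)"

definition state_space :: "nat \<Rightarrow> (int ^ 'n) set" where
  "state_space N = {x. (\<forall>k. 0 \<le> x $ k) \<and> vsum x \<le> int N}"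

definition W1 :: "int \<Rightarrow> int \<Rightarrow> real \<Rightarrow> real" where
  "W1 x y a =
     (if 0 \<le> x \<and> x \<le> y
      then real (nat y choose nat x) * a ^ nat x * (1 - a) ^ nat (y - x)
      else 0)"

definition Wn :: "int ^ 'n \<Rightarrow> int \<Rightarrow> real ^ 'n \<Rightarrow> real" where
  "Wn x M \<beta> =
     (if (\<forall>k. 0 \<le> x $ k) \<and> vsum x \<le> M
      then fact (nat M) / ((\<Prod>k\<in>UNIV. fact (nat (x $ k))) * fact (nat (M - vsum x)))
           * (1 - vsum \<beta>) ^ nat (M - vsum x) * (\<Prod>k\<in>UNIV. \<beta> $ k ^ nat (x $ k))
      else 0)"

text \<open>\<open>Kn i N \<alpha> \<beta> x y\<close> is the probability of the transition from \<open>y\<close> to \<open>x\<close>.\<close>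

fun Kn :: "chain_type \<Rightarrow> nat \<Rightarrow> real ^ 'n \<Rightarrow> real ^ 'n \<Rightarrow> int ^ 'n \<Rightarrow> int ^ 'n \<Rightarrow> real" where
  "Kn Type1 N \<alpha> \<beta> x y =
     (\<Sum>z\<in>state_space N. Wn (x - z) (int N - vsum z) \<beta> * (\<Prod>k\<in>UNIV. W1 (z $ k) (y $ k) (\<alpha> $ k)))"
| "Kn Type2 N \<alpha> \<beta> x y =
     (\<Sum>z\<in>state_space N. Wn (x - z) (int N - vsum y) \<beta> * (\<Prod>k\<in>UNIV. W1 (z $ k) (y $ k) (\<alpha> $ k)))"

fun Fmat :: "chain_type \<Rightarrow> real ^ 'n \<Rightarrow> real ^ 'n \<Rightarrow> real ^ 'n ^ 'n" where
  "Fmat Type1 \<alpha> \<beta> = (\<chi> k j. - \<alpha> $ k * \<beta> $ j + (if k = j then \<alpha> $ k else 0))"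
| "Fmat Type2 \<alpha> \<beta> = (\<chi> k j. - \<beta> $ j + (if k = j then \<alpha> $ k else 0))"

text \<open>
  \<open>lam\<close> lists the complex roots of \<open>det (t I - A) = 0\<close>, with multiplicity and in an arbitrary order.
\<close>

definition char_roots :: "real ^ 'n ^ 'n \<Rightarrow> complex ^ 'n \<Rightarrow> bool" where
  "char_roots A lam \<longleftrightarrow>
     (\<forall>t::complex. det (mat t - map_matrix complex_of_real A) = (\<Prod>j\<in>UNIV. t - lam $ j))"

fun Dn :: "chain_type \<Rightarrow> real ^ 'n \<Rightarrow> real ^ 'n \<Rightarrow> real" where
  "Dn Type1 \<alpha> \<beta> = 1 + (\<Sum>l\<in>UNIV. \<alpha> $ l * \<beta> $ l / (1 - \<alpha> $ l))"
| "Dn Type2 \<alpha> \<beta> = 1 + (\<Sum>l\<in>UNIV. \<beta> $ l / (1 - \<alpha> $ l))"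

definition rev_prob :: "chain_type \<Rightarrow> real ^ 'n \<Rightarrow> real ^ 'n \<Rightarrow> real ^ 'n" where
  "rev_prob i \<alpha> \<beta> = (\<chi> k. \<beta> $ k / (1 - \<alpha> $ k) * (1 / Dn i \<alpha> \<beta>))"

definition Tmat :: "chain_type \<Rightarrow> nat \<Rightarrow> real ^ 'n \<Rightarrow> real ^ 'n \<Rightarrow> int ^ 'n \<Rightarrow> int ^ 'n \<Rightarrow> real" where
  "Tmat i N \<alpha> \<beta> x y =
     1 / sqrt (Wn x (int N) (rev_prob i \<alpha> \<beta>)) * Kn i N \<alpha> \<beta> x y
       * sqrt (Wn y (int N) (rev_prob i \<alpha> \<beta>))"

definition P1 :: "nat \<Rightarrow> complex ^ 'n ^ 'n \<Rightarrow> 'n \<Rightarrow> int ^ 'n \<Rightarrow> complex" where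
  "P1 N u j x = 1 - 1 / of_nat N * (\<Sum>k\<in>UNIV. u $ k $ j * of_int (x $ k))"

definition left_eigen_eq ::
  "chain_type \<Rightarrow> nat \<Rightarrow> real ^ 'n \<Rightarrow> real ^ 'n \<Rightarrow> complex \<Rightarrow> (int ^ 'n \<Rightarrow> complex) \<Rightarrow> bool" where
  "left_eigen_eq i N \<alpha> \<beta> c f \<longleftrightarrow>
     (\<forall>y\<in>state_space N. (\<Sum>x\<in>state_space N. of_real (Kn i N \<alpha> \<beta> x y) * f x) = c * f y)"

definition eigenvector_on ::
  "'s set \<Rightarrow> ('s \<Rightarrow> 's \<Rightarrow> real) \<Rightarrow> complex \<Rightarrow> ('s \<Rightarrow> complex) \<Rightarrow> bool" where
  "eigenvector_on S A c v \<longleftrightarrow>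
     (\<exists>x\<in>S. v x \<noteq> 0) \<and> (\<forall>x\<in>S. (\<Sum>y\<in>S. of_real (A x y) * v y) = c * v x)"

fun sys_param :: "chain_type \<Rightarrow> real ^ 'n \<Rightarrow> complex ^ 'n \<Rightarrow> complex ^ 'n ^ 'n" where
  "sys_param Type1 \<alpha> lam =
     (\<chi> k j. of_real (\<alpha> $ k) * (lam $ j - 1) / (lam $ j - of_real (\<alpha> $ k)))"
| "sys_param Type2 \<alpha> lam = (\<chi> k j. (lam $ j - 1) / (lam $ j - of_real (\<alpha> $ k)))"

fun sum_rule :: "chain_type \<Rightarrow> real ^ 'n \<Rightarrow> real ^ 'n \<Rightarrow> complex \<Rightarrow> bool" where
  "sum_rule Type1 \<alpha> \<beta> c \<longleftrightarrow> (\<Sum>k\<in>UNIV. of_real (\<alpha> $ k * \<beta> $ k) / (c - of_real (\<alpha> $ k))) = -1"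
| "sum_rule Type2 \<alpha> \<beta> c \<longleftrightarrow> (\<Sum>k\<in>UNIV. of_real (\<beta> $ k) / (c - of_real (\<alpha> $ k))) = -1"

definition admissible :: "real ^ 'n \<Rightarrow> real ^ 'n \<Rightarrow> bool" where
  "admissible \<alpha> \<beta> \<longleftrightarrow>
     (\<forall>k. 0 < \<alpha> $ k \<and> \<alpha> $ k < 1) \<and> (\<forall>k. 0 < \<beta> $ k \<and> \<beta> $ k < 1) \<and>
     0 < vsum \<beta> \<and> vsum \<beta> < 1 \<and> (\<forall>k l. k \<noteq> l \<longrightarrow> \<alpha> $ k \<noteq> \<alpha> $ l)"

text \<open>
  \<open>f\<close> agrees on \<open>S\<close> with a quotient \<open>p / q\<close> of real polynomials, \<open>q\<close> not the zero polynomial, at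
  every point where \<open>q\<close> does not vanish. Polynomials in the coordinates of a Euclidean space are
  the library's \<^const>\<open>real_polynomial_function\<close>.
\<close>

definition rational_on :: "'a::euclidean_space set \<Rightarrow> ('a \<Rightarrow> complex) \<Rightarrow> bool" where
  "rational_on S f \<longleftrightarrow>
     (\<exists>p q. real_polynomial_function p \<and> real_polynomial_function q \<and> (\<exists>v. q v \<noteq> 0) \<and>
            (\<forall>v\<in>S. q v \<noteq> 0 \<longrightarrow> f v = of_real (p v / q v)))"

end

theory Submission
  imports Defs "HOL-Computational_Algebra.Polynomial_Factorial"
    "HOL-Computational_Algebra.Field_as_Ring"
begin

text \<open>
  In both types the characteristic matrix is a rank one perturbation \<open>diag \<alpha> - w \<beta>\<^sup>T\<close>, with
  \<open>w = \<alpha>\<close> or \<open>w = 1\<close>, and the mean of \<open>x\<close> after one step from \<open>y\<close> is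
  \<open>\<alpha>\<^sub>k y\<^sub>k + (N - \<Sum>\<^sub>l w\<^sub>l y\<^sub>l) \<beta>\<^sub>k\<close>. The matrix determinant lemma turns the characteristic equation
  into the sum rule \<open>\<Sum>\<^sub>k w\<^sub>k \<beta>\<^sub>k / (\<lambda> - \<alpha>\<^sub>k) = -1\<close>, whose roots are real, simple and different from
  \<open>1\<close> and from all \<open>\<alpha>\<^sub>k\<close>; testing the eigenvalue equation at \<open>0\<close> and at the unit vectors determines
  \<open>u\<close>. Reversibility holds separately for every intermediate state \<open>z\<close>, and gives orthogonality.

  For irrationality, let only one coordinate \<open>s = \<beta>\<^sub>m\<close> vary. If \<open>u\<close> were rational then so would be
  \<open>\<lambda> = P(s) / Q(s)\<close>. The sum rule expresses \<open>s\<close> as a rational function of \<open>\<lambda>\<close> with at least two poles,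
  namely \<open>\<infinity>\<close> and \<open>\<alpha>\<^sub>k\<close> for \<open>k \<noteq> m\<close>, so that \<open>\<lambda>(s)\<close> can take neither of these values at a finite
  \<open>s\<close>; hence \<open>Q\<close> and \<open>P - \<alpha>\<^sub>k Q\<close> are constant, and so is \<open>\<lambda>\<close>, which is absurd.
\<close>

subsection \<open>The secular equation\<close>

definition weight :: "chain_type \<Rightarrow> real ^ 'n \<Rightarrow> 'n \<Rightarrow> real" where
  "weight i \<alpha> k = (case i of Type1 \<Rightarrow> \<alpha> $ k | Type2 \<Rightarrow> 1)"

text \<open>A permutation that fixes every index except \<open>m\<close> also fixes
  \<open>m\<close>. So every permutation other than the identity moves some row index different from
  \<open>m\<close> and picks up a zero entry there.\<close>

lemma det_diagonal_except_row:
  fixes A :: "'a::comm_ring_1 ^ 'n ^ 'n"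
  assumes "\<And>i j. i \<noteq> m \<Longrightarrow> i \<noteq> j \<Longrightarrow> A $ i $ j = 0"
  shows "det A = (\<Prod>i\<in>UNIV. A $ i $ i)"
proof -
  let ?f = "\<lambda>p. of_int (sign p) * (\<Prod>i\<in>UNIV. A $ i $ p i)"
  have "?f p = 0" if p: "p permutes (UNIV :: 'n set)" "p \<noteq> id" for p
  proof -
    have "\<exists>i. i \<noteq> m \<and> p i \<noteq> i"
    proof (rule ccontr)
      assume "\<not> ?thesis"
      then have fixed: "p i = i" if "i \<noteq> m" for i using that by auto
      have "p m = m"
        using fixed injD[OF permutes_inj[OF p(1)]] by metis
      with fixed have "p = id" by (metis eq_id_iff)
      with p show False by simp
    qed
    then obtain i where "i \<noteq> m" "A $ i $ p i = 0" using assms by metis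
    then have "(\<Prod>i\<in>UNIV. A $ i $ p i) = 0" by (meson UNIV_I finite prod_zero)
    then show ?thesis by simp
  qed
  then have "(\<Sum>p\<in>{id}. ?f p) = (\<Sum>p | p permutes (UNIV :: 'n set). ?f p)"
    by (intro sum.mono_neutral_left) (auto simp: permutes_id)
  then show ?thesis by (simp add: det_def)
qed

text \<open>Row \<open>m\<close> is \<open>b\<close> itself, so multiples of it remove the rank one
  part from the other rows without changing the determinant. The set \<open>S\<close> records the
  rows that still carry this part, and the induction treats one row at a time.\<close>

lemma det_rank_one_row:
  fixes b c d :: "'n::finite \<Rightarrow> 'a::comm_ring_1"
  assumes "m \<notin> S"
  shows "det (\<chi> i j. if i = m then b j
              else (if i = j then d i else 0) + (if i \<in> S then c i * b j else 0))
         = b m * (\<Prod>l\<in>UNIV - {m}. d l)"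
  using finite[of S] assms
proof (induction S rule: finite_induct)
  case empty
  then show ?case
    by (subst det_diagonal_except_row[where m = m])
       (auto simp: prod.remove[of UNIV m] intro!: arg_cong2[where f = "(*)"] prod.cong)
next
  case (insert s S)
  let ?A = "\<chi> i j. if i = m then b j
              else (if i = j then d i else 0) + (if i \<in> S then c i * b j else 0)"
  have "(\<chi> i j. if i = m then b j
          else (if i = j then d i else 0) + (if i \<in> insert s S then c i * b j else 0))
        = (\<chi> k. if k = s then row s ?A + c s *s row m ?A else row k ?A)"
    (is "?B = _") using insert by (auto simp: vec_eq_iff row_def)
  then have "det ?B = det ?A"
    using insert by (subst \<open>?B = _\<close>, subst det_row_operation) auto
  with insert show ?case by simp
qed

text \<open>The matrix determinant lemma without division, so that it can also be evaluated where
  some \<open>d l\<close> vanishes. Adding the rank one part to row \<open>m\<close> splits the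
  determinant by linearity in that row; the new term has \<open>b\<close> as row \<open>m\<close>
  and is known from \<open>det_rank_one_row\<close>.\<close>

lemma det_diagonal_plus_rank_one:
  fixes b c d :: "'n::finite \<Rightarrow> 'a::comm_ring_1"
  shows "det (\<chi> i j. (if i = j then d i else 0) + c i * b j)
         = (\<Prod>l\<in>UNIV. d l) + (\<Sum>k\<in>UNIV. c k * b k * (\<Prod>l\<in>UNIV - {k}. d l))"
proof -
  have "det (\<chi> i j. (if i = j then d i else 0) + (if i \<in> S then c i * b j else 0))
        = (\<Prod>l\<in>UNIV. d l) + (\<Sum>k\<in>S. c k * b k * (\<Prod>l\<in>UNIV - {k}. d l))" for S :: "'n set"
    using finite[of S]
  proof (induction S rule: finite_induct)
    case empty
    show ?case by (subst det_diagonal) auto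
  next
    case (insert m S)
    let ?r = "\<lambda>i. \<chi> j. (if i = j then d i else 0) + (if i \<in> S then c i * b j else 0)"
    have "(\<chi> i j. (if i = j then d i else 0) + (if i \<in> insert m S then c i * b j else 0))
          = (\<chi> i. if i = m then ?r i + c m *s (\<chi> j. b j) else ?r i)"
      using insert by (auto simp: vec_eq_iff)
    then have "det (\<chi> i j. (if i = j then d i else 0) + (if i \<in> insert m S then c i * b j else 0))
          = det (\<chi> i. if i = m then ?r i else ?r i)
            + c m * det (\<chi> i. if i = m then \<chi> j. b j else ?r i)"
      by (simp only: det_row_add det_row_mul)
    also have "(\<chi> i. if i = m then \<chi> j. b j else ?r i) =
        (\<chi> i j. if i = m then b j
              else (if i = j then d i else 0) + (if i \<in> S then c i * b j else 0))"
      by (auto simp: vec_eq_iff)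
    finally show ?case
      using insert by (simp add: det_rank_one_row algebra_simps)
  qed
  from this[of UNIV] show ?thesis by simp
qed

lemma Fmat_nth:
  "Fmat i \<alpha> \<beta> $ k $ j = (if k = j then \<alpha> $ k else 0) - weight i \<alpha> k * \<beta> $ j"
  by (cases i) (auto simp: weight_def)

lemma char_roots_prod:
  assumes "char_roots (Fmat i \<alpha> \<beta>) lam"
  shows "(\<Prod>j\<in>UNIV. t - lam $ j) = (\<Prod>k\<in>UNIV. t - of_real (\<alpha> $ k))
     + (\<Sum>k\<in>UNIV. of_real (weight i \<alpha> k * \<beta> $ k) * (\<Prod>l\<in>UNIV - {k}. t - of_real (\<alpha> $ l)))"
proof -
  have "mat t - map_matrix complex_of_real (Fmat i \<alpha> \<beta>)
      = (\<chi> k j. (if k = j then t - of_real (\<alpha> $ k) else 0)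
            + of_real (weight i \<alpha> k) * of_real (\<beta> $ j))"
    by (auto simp: vec_eq_iff mat_def Fmat_nth)
  moreover have "(\<Prod>j\<in>UNIV. t - lam $ j) = det (mat t - map_matrix complex_of_real (Fmat i \<alpha> \<beta>))"
    using assms by (simp add: char_roots_def)
  ultimately show ?thesis
    by (simp add: det_diagonal_plus_rank_one)
qed

section \<open>Location and simplicity of the roots of the secular equation\<close>

context
  fixes a w :: "'n::finite \<Rightarrow> real" and lam :: "'n \<Rightarrow> complex"
  assumes inj_a: "inj a" and w_pos: "\<And>k. 0 < w k"
    and lam_prod: "\<And>t. (\<Prod>j\<in>UNIV. t - lam j) = (\<Prod>k\<in>UNIV. t - of_real (a k))
        + (\<Sum>k\<in>UNIV. of_real (w k) * (\<Prod>l\<in>UNIV - {k}. t - of_real (a l)))"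
begin

lemma secular_prod:
  assumes "\<And>k. t \<noteq> of_real (a k)"
  shows "(\<Prod>j\<in>UNIV. t - lam j) =
     (\<Prod>k\<in>UNIV. t - of_real (a k)) * (1 + (\<Sum>k\<in>UNIV. of_real (w k) / (t - of_real (a k))))"
proof -
  have "of_real (w k) * (\<Prod>l\<in>UNIV - {k}. t - of_real (a l))
      = (\<Prod>k\<in>UNIV. t - of_real (a k)) * (of_real (w k) / (t - of_real (a k)))" for k
    using assms[of k] prod.remove[of UNIV k "\<lambda>l. t - complex_of_real (a l)"] by simp
  then show ?thesis
    by (simp add: lam_prod sum_distrib_left distrib_left)
qed

text \<open>At \<open>t = a k\<close> every product containing the factor \<open>t - a k\<close>
  vanishes. Only the \<open>k\<close>-th summand survives, and it is nonzero because the poles are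
  distinct and \<open>w k\<close> is positive.\<close>

lemma root_neq_pole: "lam j \<noteq> of_real (a k)"
proof
  assume eq: "lam j = of_real (a k)"
  have zero: "(\<Prod>l\<in>UNIV - {m}. of_real (a k) - of_real (a l)) = (0::complex)" if "m \<noteq> k" for m
    using that by auto
  have "(\<Prod>i\<in>UNIV. of_real (a k) - lam i) = 0"
    using eq by (auto intro!: exI[of _ j])
  moreover have "(\<Prod>l\<in>UNIV. of_real (a k) - of_real (a l)) = (0::complex)"
    by auto
  ultimately have "(\<Sum>m\<in>UNIV. of_real (w m) *
      (\<Prod>l\<in>UNIV - {m}. of_real (a k) - of_real (a l))) = (0::complex)"
    by (simp add: lam_prod)
  also have "(\<Sum>m\<in>UNIV. of_real (w m) * (\<Prod>l\<in>UNIV - {m}. of_real (a k) - of_real (a l)))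
      = (of_real (w k) * (\<Prod>l\<in>UNIV - {k}. of_real (a k) - of_real (a l)) :: complex)"
    by (subst sum.remove[of UNIV k]) (auto intro!: sum.neutral simp: zero simp del: prod_zero_iff)
  finally show False
    using w_pos[of k] injD[OF inj_a, of k] by auto
qed

lemma secular_eq: "(\<Sum>k\<in>UNIV. of_real (w k) / (lam j - of_real (a k))) = -1"
proof -
  have "(\<Prod>i\<in>UNIV. lam j - lam i) = 0" by auto
  then show ?thesis
    using root_neq_pole[of j] by (subst (asm) secular_prod) (auto simp: add_eq_0_iff)
qed

text \<open>All weights are positive, so at a non-real point the imaginary parts of all summands
  have the same sign, opposite to that of the point. Their sum cannot be the real number
  \<open>-1\<close>.\<close>

lemma root_real: "lam j \<in> \<real>"
proof (rule ccontr)
  let ?z = "lam j"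
  assume "?z \<notin> \<real>"
  then have im: "Im ?z \<noteq> 0" by (simp add: complex_is_Real_iff)
  have "Im (of_real (w k) / (?z - of_real (a k)))
      = - Im ?z * (w k / (cmod (?z - of_real (a k)))\<^sup>2)" for k
    by (simp add: Im_divide cmod_power2)
  then have "Im (\<Sum>k\<in>UNIV. of_real (w k) / (?z - of_real (a k)))
      = - Im ?z * (\<Sum>k\<in>UNIV. w k / (cmod (?z - of_real (a k)))\<^sup>2)"
    by (simp add: sum_distrib_left)
  with secular_eq[of j] im have "(\<Sum>k\<in>UNIV. w k / (cmod (?z - of_real (a k)))\<^sup>2) = 0"
    by simp
  moreover have "(\<Sum>k\<in>UNIV. w k / (cmod (?z - of_real (a k)))\<^sup>2) > 0"
    using root_neq_pole[of j] w_pos by (intro sum_pos) auto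
  ultimately show False by simp
qed

text \<open>The derivative of the secular function is negative on the real line, hence no double roots.\<close>

lemma inj_roots: "inj lam"
proof (rule injI, rule ccontr)
  fix j l assume eq: "lam j = lam l" and "j \<noteq> l"
  let ?c = "lam j" and ?a = "\<lambda>k. complex_of_real (a k)" and ?w = "\<lambda>k. complex_of_real (w k)"
  let ?R = "\<lambda>t. \<Prod>i\<in>UNIV - {j, l}. t - lam i"
  let ?G = "\<lambda>t. \<Sum>k\<in>UNIV. ?w k / ((t - ?a k) * (?c - ?a k))"
  \<comment> \<open>\<open>?G\<close> is minus the difference quotient of the secular sum between
    \<open>t\<close> and \<open>?c\<close>. If two roots coincide, both sides of the product formula
    contain \<open>t - ?c\<close>, and one copy is cancelled here, which needs
    \<open>t \<noteq> ?c\<close>.\<close>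
  have away: "(t - ?c) * ?R t = - (\<Prod>k\<in>UNIV. t - ?a k) * ?G t"
    if t: "\<And>k. t \<noteq> ?a k" "t \<noteq> ?c" for t
  proof -
    have "?w k / (t - ?a k) - ?w k / (?c - ?a k)
        = - (t - ?c) * (?w k / ((t - ?a k) * (?c - ?a k)))" for k
      using t(1)[of k] root_neq_pole[of j k] by (simp add: divide_simps) (simp add: algebra_simps)
    then have "(\<Sum>k\<in>UNIV. ?w k / (t - ?a k)) - (\<Sum>k\<in>UNIV. ?w k / (?c - ?a k))
        = - (t - ?c) * ?G t"
      by (simp add: sum_subtractf[symmetric] sum_distrib_left)
    then have "1 + (\<Sum>k\<in>UNIV. ?w k / (t - ?a k)) = - (t - ?c) * ?G t"
      by (simp add: secular_eq algebra_simps)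
    moreover have "(\<Prod>i\<in>UNIV. t - lam i) = (t - ?c) * ((t - ?c) * ?R t)"
    proof -
      have "(\<Prod>i\<in>UNIV. t - lam i) = (t - lam j) * (\<Prod>i\<in>UNIV - {j}. t - lam i)"
        by (rule prod.remove) auto
      also have "(\<Prod>i\<in>UNIV - {j}. t - lam i) = (t - lam l) * (\<Prod>i\<in>UNIV - {j} - {l}. t - lam i)"
        using \<open>j \<noteq> l\<close> by (intro prod.remove) auto
      also have "UNIV - {j} - {l} = UNIV - {j, l}" by auto
      finally show ?thesis by (simp add: eq)
    qed
    ultimately have prod_eq: "(t - ?c) * ((t - ?c) * ?R t) = (\<Prod>k\<in>UNIV. t - ?a k) * (- (t - ?c) * ?G t)"
      using secular_prod[OF t(1)] by simp
    have "x * r = - p * g" if "x * (x * r) = p * (- x * g)" "x \<noteq> 0" for x r p g :: complex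
    proof -
      have "x * (x * r + p * g) = 0" using that(1) by (simp add: algebra_simps)
      with that(2) show ?thesis by (simp add: add_eq_0_iff2)
    qed
    from this[OF prod_eq] t(2) show ?thesis by (simp only: right_minus_eq simp_thms)
  qed
  have ev: "eventually (\<lambda>t. (t - ?c) * ?R t = - (\<Prod>k\<in>UNIV. t - ?a k) * ?G t) (at ?c)"
  proof -
    have "eventually (\<lambda>t. t \<noteq> ?a k) (at ?c)" for k
      by (rule tendsto_imp_eventually_ne[OF tendsto_ident_at root_neq_pole])
    then have "eventually (\<lambda>t. \<forall>k. t \<noteq> ?a k) (at ?c)"
      by (simp add: eventually_all_finite)
    moreover have "eventually (\<lambda>t. t \<noteq> ?c) (at ?c)"
      by (simp add: eventually_at_filter)
    ultimately show ?thesis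
      by eventually_elim (rule away, auto)
  qed
  \<comment> \<open>The cancelled identity extends to \<open>?c\<close> by continuity. There the
    left side is zero, so \<open>?G ?c = 0\<close>, although for the real number \<open>?c\<close>
    it is a sum of positive terms.\<close>
  have "((\<lambda>t. (t - ?c) * ?R t) \<longlongrightarrow> (?c - ?c) * ?R ?c) (at ?c)"
    by (intro tendsto_intros)
  then have lim1: "((\<lambda>t. - (\<Prod>k\<in>UNIV. t - ?a k) * ?G t) \<longlongrightarrow> (?c - ?c) * ?R ?c) (at ?c)"
    using ev by (rule Lim_transform_eventually)
  have nz: "(?c - ?a k) * (?c - ?a k) \<noteq> 0" for k
    using root_neq_pole[of j k] by simp
  have lim2: "((\<lambda>t. - (\<Prod>k\<in>UNIV. t - ?a k) * ?G t)
      \<longlongrightarrow> - (\<Prod>k\<in>UNIV. ?c - ?a k) * ?G ?c) (at ?c)"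
    by (intro tendsto_intros nz)
  have "(?c - ?c) * ?R ?c = - (\<Prod>k\<in>UNIV. ?c - ?a k) * ?G ?c"
    by (rule tendsto_unique[OF at_neq_bot lim1 lim2])
  then have "?G ?c = 0" using root_neq_pole by auto
  moreover obtain r where r: "?c = of_real r" using root_real[of j] by (auto elim: Reals_cases)
  ultimately have "complex_of_real (\<Sum>k\<in>UNIV. w k / ((r - a k) * (r - a k))) = 0"
    by (simp add: of_real_sum)
  then have "(\<Sum>k\<in>UNIV. w k / ((r - a k) * (r - a k))) = 0"
    by (simp only: of_real_eq_0_iff)
  moreover have "r \<noteq> a k" for k using root_neq_pole[of j k] r by auto
  then have "(\<Sum>k\<in>UNIV. w k / ((r - a k) * (r - a k))) > 0"
    using w_pos by (intro sum_pos) (auto simp flip: power2_eq_square)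
  ultimately show False by simp
qed

text \<open>All poles lie below \<open>1\<close>, so every summand is positive there. This separates
  the roots from the eigenvalue \<open>1\<close> of the constant function, as orthogonality to
  constants requires.\<close>

lemma root_neq_one:
  assumes "\<And>k. a k < 1"
  shows "lam j \<noteq> 1"
proof
  assume "lam j = 1"
  with secular_eq[of j] have "complex_of_real (\<Sum>k\<in>UNIV. w k / (1 - a k)) = of_real (-1)"
    by (simp add: of_real_sum)
  then have "(\<Sum>k\<in>UNIV. w k / (1 - a k)) = -1" by (simp only: of_real_eq_iff)
  moreover have "(\<Sum>k\<in>UNIV. w k / (1 - a k)) > 0"
    using assms w_pos by (intro sum_pos) auto
  ultimately show False by simp
qed

end

subsection \<open>Moments and reversibility of the transition kernels\<close>

lemma finite_state_space [simp]: "finite (state_space N :: (int ^ 'n) set)"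
proof (rule finite_subset)
  show "state_space N \<subseteq> vec_lambda ` (PiE UNIV (\<lambda>_::'n. {0..int N}))"
  proof
    fix x :: "int ^ 'n" assume x: "x \<in> state_space N"
    have "x $ k \<le> vsum x" for k
      using x unfolding vsum_def state_space_def by (intro member_le_sum) auto
    moreover have "vsum x \<le> int N" "\<forall>k. 0 \<le> x $ k" using x by (simp_all add: state_space_def)
    ultimately have "0 \<le> x $ k" "x $ k \<le> int N" for k by (blast, meson order_trans)
    then have "vec_nth x \<in> PiE UNIV (\<lambda>_. {0..int N})" by auto
    then show "x \<in> vec_lambda ` (PiE UNIV (\<lambda>_. {0..int N}))"
      by (metis vec_nth_inverse imageI)
  qed
qed (intro finite_imageI finite_PiE, auto)

section \<open>Recursion, mass and mean of the multinomial distribution\<close>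

lemma vsum_add: "vsum (x + y) = vsum x + vsum y"
  by (simp add: vsum_def sum.distrib)

lemma vsum_diff: "vsum (x - y) = vsum x - vsum (y :: 'a::ab_group_add ^ 'n)"
  by (simp add: vsum_def sum_subtractf)

lemma vsum_axis [simp]: "vsum (axis k c) = c"
  by (simp add: vsum_def axis_def)

lemma vsum_0 [simp]: "vsum 0 = 0"
  by (simp add: vsum_def)

lemma vsum_mono: "(\<And>k. x $ k \<le> y $ k) \<Longrightarrow> vsum x \<le> vsum (y :: int ^ 'n)"
  by (simp add: vsum_def sum_mono)

lemma state_space_0: "state_space 0 = {0}"
proof -
  have "x = 0" if "\<forall>k. 0 \<le> x $ k" "vsum x \<le> 0" for x :: "int ^ 'n"
  proof -
    have "vsum x = 0" using that by (simp add: vsum_def sum_nonneg antisym)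
    then show ?thesis using that(1) by (simp add: vsum_def sum_nonneg_eq_0_iff vec_eq_iff)
  qed
  then show ?thesis by (auto simp: state_space_def)
qed

lemma Wn_eq_0: "w \<notin> state_space M \<Longrightarrow> Wn w (int M) \<beta> = 0"
  by (auto simp: Wn_def state_space_def)

text \<open>Substitution \<open>x = w + z\<close>: the weight vanishes unless \<open>x - z\<close>
  lies in the smaller simplex, and the translate of that simplex by \<open>z\<close> stays inside
  the larger one.\<close>

lemma sum_Wn_shift:
  fixes g :: "int ^ 'n \<Rightarrow> real"
  assumes "\<And>k. 0 \<le> z $ k" "vsum z + int M \<le> int N"
  shows "(\<Sum>x\<in>state_space N. Wn (x - z) (int M) \<beta> * g x)
       = (\<Sum>w\<in>state_space M. Wn w (int M) \<beta> * g (w + z))"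
proof -
  have "(\<Sum>w\<in>state_space M. Wn w (int M) \<beta> * g (w + z))
      = (\<Sum>x\<in>(\<lambda>w. w + z) ` state_space M. Wn (x - z) (int M) \<beta> * g x)"
    by (subst sum.reindex) (auto simp: inj_on_def)
  also have "\<dots> = (\<Sum>x\<in>state_space N. Wn (x - z) (int M) \<beta> * g x)"
  proof (intro sum.mono_neutral_left ballI)
    show "(\<lambda>w. w + z) ` state_space M \<subseteq> state_space N"
      using assms by (force simp: state_space_def vsum_add)
    fix x assume "x \<in> state_space N - (\<lambda>w. w + z) ` state_space M"
    then have "x - z \<notin> state_space M" by (metis DiffD2 diff_add_cancel imageI)
    then show "Wn (x - z) (int M) \<beta> * g x = 0" by (simp add: Wn_eq_0)
  qed simp
  finally show ?thesis by simp
qed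

text \<open>The share of the remaining cell, of probability \<open>1 - vsum \<beta>\<close>, in the
  recursion over the number of particles; \<open>Wn_Suc_axis\<close> gives the share of cell
  \<open>k\<close>.\<close>

lemma Wn_Suc_rest:
  "real (Suc M) * ((1 - vsum \<beta>) * Wn w (int M) \<beta>)
   = real_of_int (int (Suc M) - vsum w) * Wn w (int (Suc M)) \<beta>"
proof (cases "w \<in> state_space M")
  case True
  then have "0 \<le> vsum w" by (simp add: state_space_def vsum_def sum_nonneg)
  then obtain s where s: "vsum w = int s" by (metis nonneg_int_cases)
  with True obtain r where M: "M = s + r" by (auto simp: state_space_def le_iff_add)
  define b A B where "b = 1 - vsum \<beta>"
    and "A = (\<Prod>k\<in>UNIV. fact (nat (w $ k)) :: real)" and "B = (\<Prod>k\<in>UNIV. \<beta> $ k ^ nat (w $ k))"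
  have A: "A \<noteq> 0" by (simp add: A_def)
  have w: "\<forall>k. 0 \<le> w $ k" using True by (simp add: state_space_def)
  have "Wn w (int M) \<beta> = fact M / (A * fact r) * b ^ r * B"
  proof -
    have "nat (int M - vsum w) = r" using s M by simp
    moreover have "vsum w \<le> int M" using s M by simp
    ultimately show ?thesis using w by (simp add: Wn_def A_def B_def b_def)
  qed
  moreover have "Wn w (int (Suc M)) \<beta> = fact (Suc M) / (A * fact (Suc r)) * b ^ Suc r * B"
  proof -
    have "nat (int (Suc M) - vsum w) = Suc r" using s M by simp
    moreover have "vsum w \<le> int (Suc M)" using s M by simp
    ultimately show ?thesis
      using w by (simp only: Wn_def A_def B_def b_def nat_int simp_thms if_True)
  qed
  moreover have "real_of_int (int (Suc M) - vsum w) = real (Suc r)" using s M by simp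
  moreover have "real (Suc M) * (b * (fact M / (A * fact r) * b ^ r * B))
      = real (Suc r) * (fact (Suc M) / (A * fact (Suc r)) * b ^ Suc r * B)"
    using A by (simp add: field_simps del: of_nat_Suc)
  ultimately show ?thesis by (simp only: b_def)
next
  case False
  then show ?thesis
    \<comment> \<open>On the new boundary layer \<open>vsum w = Suc M\<close> the factor on the
      right is zero; elsewhere outside the simplex both weights vanish.\<close>
    by (cases "vsum w = int (Suc M)") (auto simp: Wn_eq_0 Wn_def state_space_def)
qed

lemma Wn_Suc_axis:
  "real (Suc M) * (\<beta> $ k * Wn (w - axis k 1) (int M) \<beta>)
   = real_of_int (w $ k) * Wn w (int (Suc M)) \<beta>"
proof (cases "w - axis k 1 \<in> state_space M")
  case True
  define v where "v = w - axis k 1"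
  then have w: "w $ l = v $ l + (if l = k then 1 else 0)" for l
    by (simp add: axis_def)
  have v: "0 \<le> v $ l" "vsum v \<le> int M" for l
    using True by (simp_all add: state_space_def flip: v_def)
  have sw: "vsum w = vsum v + 1" by (simp add: v_def vsum_diff)
  define r q b where "r = nat (v $ k)" and "q = nat (int M - vsum v)" and "b = 1 - vsum \<beta>"
  define A B where "A = (\<Prod>l\<in>UNIV - {k}. fact (nat (v $ l)) :: real)"
    and "B = (\<Prod>l\<in>UNIV - {k}. \<beta> $ l ^ nat (v $ l))"
  have A: "A \<noteq> 0" by (simp add: A_def)
  have "(\<Prod>l\<in>UNIV - {k}. fact (nat (w $ l))) = A"
    unfolding A_def by (intro prod.cong) (auto simp: w)
  moreover have "(\<Prod>l\<in>UNIV - {k}. \<beta> $ l ^ nat (w $ l)) = B"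
    unfolding B_def by (intro prod.cong) (auto simp: w)
  moreover have "nat (w $ k) = Suc r" using v(1)[of k] by (simp add: w r_def)
  moreover have "\<forall>l. 0 \<le> w $ l" using v(1) by (auto simp: w)
  moreover have "nat (int (Suc M) - vsum w) = q" by (simp add: sw q_def)
  moreover have "vsum w \<le> int (Suc M)" using v(2) by (simp add: sw)
  ultimately have "Wn w (int (Suc M)) \<beta>
      = fact (Suc M) / (fact (Suc r) * A * fact q) * b ^ q * (\<beta> $ k ^ Suc r * B)"
    by (simp only: Wn_def b_def prod.remove[of UNIV k] finite_class.finite_UNIV UNIV_I nat_int
        simp_thms if_True)
  moreover have "Wn v (int M) \<beta> = fact M / (fact r * A * fact q) * b ^ q * (\<beta> $ k ^ r * B)"
    using v by (simp add: Wn_def b_def r_def q_def A_def B_def prod.remove[of UNIV k])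
  moreover have "real_of_int (w $ k) = real (Suc r)" using v(1)[of k] by (simp add: w r_def)
  moreover have "real (Suc M) * (\<beta> $ k * (fact M / (fact r * A * fact q) * b ^ q * (\<beta> $ k ^ r * B)))
      = real (Suc r) * (fact (Suc M) / (fact (Suc r) * A * fact q) * b ^ q * (\<beta> $ k ^ Suc r * B))"
    using A by (simp add: field_simps del: of_nat_Suc)
  ultimately show ?thesis by (simp only: v_def)
next
  case False
  have "w \<notin> state_space (Suc M)" if "w $ k \<noteq> 0"
  proof
    assume w: "w \<in> state_space (Suc M)"
    then have nonneg: "0 \<le> w $ l" for l by (simp add: state_space_def)
    with that have "1 \<le> w $ k" by (metis int_one_le_iff_zero_less order_le_less)
    with nonneg have "0 \<le> (w - axis k 1) $ l" for l by (auto simp: axis_def)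
    with w have "w - axis k 1 \<in> state_space M" by (simp add: state_space_def vsum_diff)
    with False show False ..
  qed
  then have "real_of_int (w $ k) * Wn w (int (Suc M)) \<beta> = 0"
    using Wn_eq_0 by fastforce
  with Wn_eq_0[OF False] show ?thesis by simp
qed

text \<open>Pascal's rule for multinomial weights, splitting by the cell of the last particle. The
  coefficients \<open>Suc M - vsum w\<close> and \<open>w $ k\<close> of the two preceding
  identities add up to \<open>Suc M\<close>.\<close>

lemma Wn_Suc:
  "Wn w (int (Suc M)) \<beta>
   = (1 - vsum \<beta>) * Wn w (int M) \<beta> + (\<Sum>k\<in>UNIV. \<beta> $ k * Wn (w - axis k 1) (int M) \<beta>)"
proof -
  have "real (Suc M) * ((1 - vsum \<beta>) * Wn w (int M) \<beta>
          + (\<Sum>k\<in>UNIV. \<beta> $ k * Wn (w - axis k 1) (int M) \<beta>))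
      = (real_of_int (int (Suc M) - vsum w) + (\<Sum>k\<in>UNIV. real_of_int (w $ k)))
          * Wn w (int (Suc M)) \<beta>"
    unfolding distrib_left sum_distrib_left distrib_right sum_distrib_right
    by (simp only: Wn_Suc_rest Wn_Suc_axis)
  also have "\<dots> = real (Suc M) * Wn w (int (Suc M)) \<beta>"
    by (simp add: vsum_def)
  finally show ?thesis by simp
qed

text \<open>The recursion in terms of expectations. Mass and mean then follow by induction on
  \<open>M\<close>, without further work on multinomial coefficients.\<close>

lemma sum_Wn_Suc:
  fixes g :: "int ^ 'n \<Rightarrow> real"
  shows "(\<Sum>w\<in>state_space (Suc M). Wn w (int (Suc M)) \<beta> * g w)
   = (1 - vsum \<beta>) * (\<Sum>w\<in>state_space M. Wn w (int M) \<beta> * g w)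
     + (\<Sum>k\<in>UNIV. \<beta> $ k * (\<Sum>w\<in>state_space M. Wn w (int M) \<beta> * g (w + axis k 1)))"
proof -
  have 0: "(\<Sum>w\<in>state_space (Suc M). Wn w (int M) \<beta> * g w)
      = (\<Sum>w\<in>state_space M. Wn w (int M) \<beta> * g w)"
    using sum_Wn_shift[of 0 M "Suc M" \<beta> g] by simp
  have k: "(\<Sum>w\<in>state_space (Suc M). Wn (w - axis k 1) (int M) \<beta> * g w)
      = (\<Sum>w\<in>state_space M. Wn w (int M) \<beta> * g (w + axis k 1))" for k
    by (rule sum_Wn_shift) (simp add: axis_def, simp)
  have "(\<Sum>w\<in>state_space (Suc M). Wn w (int (Suc M)) \<beta> * g w)
      = (1 - vsum \<beta>) * (\<Sum>w\<in>state_space (Suc M). Wn w (int M) \<beta> * g w)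
        + (\<Sum>w\<in>state_space (Suc M). \<Sum>k\<in>UNIV. \<beta> $ k * (Wn (w - axis k 1) (int M) \<beta> * g w))"
    by (simp only: Wn_Suc distrib_right sum.distrib sum_distrib_left sum_distrib_right mult.assoc)
  also have "(\<Sum>w\<in>state_space (Suc M). \<Sum>k\<in>UNIV. \<beta> $ k * (Wn (w - axis k 1) (int M) \<beta> * g w))
      = (\<Sum>k\<in>UNIV. \<beta> $ k * (\<Sum>w\<in>state_space M. Wn w (int M) \<beta> * g (w + axis k 1)))"
    by (subst sum.swap) (simp only: sum_distrib_left[symmetric] k)
  finally show ?thesis by (simp only: 0)
qed

lemma sum_Wn: "(\<Sum>w\<in>state_space M. Wn w (int M) \<beta>) = 1"
proof (induction M)
  case 0
  show ?case by (simp add: state_space_0 Wn_def)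
next
  case (Suc M)
  then show ?case using sum_Wn_Suc[of M \<beta> "\<lambda>_. 1"] by (simp add: vsum_def)
qed

lemma sum_Wn_nth: "(\<Sum>w\<in>state_space M. Wn w (int M) \<beta> * real_of_int (w $ m)) = real M * \<beta> $ m"
proof (induction M)
  case 0
  show ?case by (simp add: state_space_0)
next
  case (Suc M)
  have "(\<Sum>w\<in>state_space M. Wn w (int M) \<beta> * real_of_int ((w + axis k 1) $ m))
      = real M * \<beta> $ m + (if k = m then 1 else 0)" for k
  proof -
    have "(\<Sum>w\<in>state_space M. Wn w (int M) \<beta> * real_of_int ((w + axis k 1) $ m))
        = (\<Sum>w\<in>state_space M. Wn w (int M) \<beta> * real_of_int (w $ m))
          + (\<Sum>w\<in>state_space M. Wn w (int M) \<beta>) * (if k = m then 1 else 0)"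
      unfolding sum_distrib_right sum.distrib[symmetric]
      by (intro sum.cong) (auto simp: axis_def algebra_simps)
    then show ?thesis by (simp only: Suc sum_Wn mult_1)
  qed
  then have "(\<Sum>w\<in>state_space (Suc M). Wn w (int (Suc M)) \<beta> * real_of_int (w $ m))
      = (1 - vsum \<beta>) * (real M * \<beta> $ m)
        + (\<Sum>k\<in>UNIV. \<beta> $ k * (real M * \<beta> $ m + (if k = m then 1 else 0)))"
    by (simp only: sum_Wn_Suc Suc)
  also have "(\<Sum>k\<in>UNIV. \<beta> $ k * (real M * \<beta> $ m + (if k = m then 1 else 0)))
      = vsum \<beta> * (real M * \<beta> $ m) + \<beta> $ m"
    unfolding distrib_left sum.distrib sum_distrib_right vsum_def
    by (simp add: if_distrib cong: if_cong)
  finally show ?case by (simp add: algebra_simps)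
qed

section \<open>Mass and mean of binomial thinning\<close>

lemma sum_int_atMost: "(\<Sum>v\<in>{0..int n}. f v) = (\<Sum>k\<le>n. f (int k))"
  by (rule sum.reindex_bij_witness[of _ int nat]) auto

text \<open>Identifies the binomial weights with Bernstein polynomials, whose sums are
  known.\<close>

lemma W1_int: "k \<le> n \<Longrightarrow> W1 (int k) (int n) a = Bernstein n k a"
  by (simp add: W1_def Bernstein_def nat_diff_distrib flip: of_nat_diff)

lemma sum_W1: "0 \<le> y \<Longrightarrow> (\<Sum>v\<in>{0..y}. W1 v y a) = 1"
  by (elim nonneg_int_cases) (simp add: sum_int_atMost W1_int)

lemma sum_W1_mult: "0 \<le> y \<Longrightarrow> (\<Sum>v\<in>{0..y}. W1 v y a * real_of_int v) = a * real_of_int y"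
  using sum_k_Bernstein[of "nat y" a]
  by (elim nonneg_int_cases) (simp add: sum_int_atMost W1_int mult.commute)

text \<open>The summand is supported on the box \<open>0 \<le> z $ k \<le> y $ k\<close>, which lies
  in the simplex because \<open>y\<close> does; over a box the sum of products factors.\<close>

lemma sum_state_space_prod:
  fixes f :: "'n::finite \<Rightarrow> int \<Rightarrow> real"
  assumes "y \<in> state_space N"
    and f: "\<And>k v. v \<notin> {0..y $ k} \<Longrightarrow> f k v = 0"
  shows "(\<Sum>z\<in>state_space N. \<Prod>k\<in>UNIV. f k (z $ k)) = (\<Prod>k\<in>UNIV. \<Sum>v\<in>{0..y $ k}. f k v)"
proof -
  let ?B = "PiE UNIV (\<lambda>k. {0..y $ k})"
  have "(\<Prod>k\<in>UNIV. \<Sum>v\<in>{0..y $ k}. f k v) = (\<Sum>g\<in>?B. \<Prod>k\<in>UNIV. f k (g k))"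
    by (rule prod_sum_PiE) auto
  also have "\<dots> = (\<Sum>z\<in>vec_lambda ` ?B. \<Prod>k\<in>UNIV. f k (z $ k))"
    by (subst sum.reindex) (auto simp: inj_on_def vec_lambda_inject)
  also have "\<dots> = (\<Sum>z\<in>state_space N. \<Prod>k\<in>UNIV. f k (z $ k))"
  proof (intro sum.mono_neutral_left ballI)
    show "vec_lambda ` ?B \<subseteq> state_space N"
    proof
      fix z assume "z \<in> vec_lambda ` ?B"
      then have z: "0 \<le> z $ k" "z $ k \<le> y $ k" for k by (auto simp: PiE_iff)
      then have "vsum z \<le> vsum y" by (intro vsum_mono)
      with z assms(1) show "z \<in> state_space N" by (auto simp: state_space_def)
    qed
    fix z assume "z \<in> state_space N - vec_lambda ` ?B"
    then have "vec_nth z \<notin> ?B" by (metis DiffD2 imageI vec_nth_inverse)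
    then obtain k where "z $ k \<notin> {0..y $ k}" by (auto simp: PiE_iff)
    with f have "f k (z $ k) = 0" by blast
    then show "(\<Prod>k\<in>UNIV. f k (z $ k)) = 0" by (meson UNIV_I finite prod_zero)
  qed simp
  finally show ?thesis by simp
qed

definition thinning :: "real ^ 'n \<Rightarrow> int ^ 'n \<Rightarrow> int ^ 'n \<Rightarrow> real" where
  "thinning \<alpha> z y = (\<Prod>k\<in>UNIV. W1 (z $ k) (y $ k) (\<alpha> $ k))"

lemma thinning_eq_0: "\<not> (0 \<le> z $ k \<and> z $ k \<le> y $ k) \<Longrightarrow> thinning \<alpha> z y = 0"
  by (auto simp: thinning_def W1_def intro!: exI[of _ k])

lemma sum_thinning:
  assumes "y \<in> state_space N"
  shows "(\<Sum>z\<in>state_space N. thinning \<alpha> z y) = 1"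
proof -
  have "(\<Sum>z\<in>state_space N. thinning \<alpha> z y)
      = (\<Prod>k\<in>UNIV. \<Sum>v\<in>{0..y $ k}. W1 v (y $ k) (\<alpha> $ k))"
    unfolding thinning_def by (rule sum_state_space_prod[OF assms]) (auto simp: W1_def)
  also have "\<dots> = 1"
    using assms by (intro prod.neutral) (simp add: sum_W1 state_space_def)
  finally show ?thesis .
qed

lemma sum_thinning_nth:
  assumes "y \<in> state_space N"
  shows "(\<Sum>z\<in>state_space N. thinning \<alpha> z y * real_of_int (z $ m)) = \<alpha> $ m * real_of_int (y $ m)"
proof -
  \<comment> \<open>Absorbing the factor \<open>z $ m\<close> into coordinate \<open>m\<close> keeps
    the summand a product over the coordinates.\<close>
  let ?f = "\<lambda>k v. W1 v (y $ k) (\<alpha> $ k) * (if k = m then real_of_int v else 1)"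
  have y: "0 \<le> y $ k" for k using assms by (simp add: state_space_def)
  have "(\<Sum>z\<in>state_space N. thinning \<alpha> z y * real_of_int (z $ m))
      = (\<Sum>z\<in>state_space N. \<Prod>k\<in>UNIV. ?f k (z $ k))"
    by (simp add: thinning_def prod.distrib)
  also have "\<dots> = (\<Prod>k\<in>UNIV. \<Sum>v\<in>{0..y $ k}. ?f k v)"
    by (rule sum_state_space_prod[OF assms]) (auto simp: W1_def)
  also have "\<dots> = (\<Prod>k\<in>UNIV. if k = m then \<alpha> $ k * real_of_int (y $ k) else 1)"
    using y by (intro prod.cong) (auto simp: sum_W1 sum_W1_mult)
  finally show ?thesis by simp
qed

section \<open>Mass and mean of one step of the chain\<close>

text \<open>The number of multinomially placed particles is \<open>N - vsum (retained i z y)\<close>: the chain of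
  type 1 places the particles removed by the thinning again, the chain of type 2 does not.\<close>

definition retained :: "chain_type \<Rightarrow> int ^ 'n \<Rightarrow> int ^ 'n \<Rightarrow> int ^ 'n" where
  "retained i z y = (case i of Type1 \<Rightarrow> z | Type2 \<Rightarrow> y)"

lemma Kn_eq:
  "Kn i N \<alpha> \<beta> x y
   = (\<Sum>z\<in>state_space N. Wn (x - z) (int N - vsum (retained i z y)) \<beta> * thinning \<alpha> z y)"
  by (cases i) (simp_all add: retained_def thinning_def)

text \<open>The factor \<open>thinning\<close> makes both identities trivial unless \<open>z\<close>
  lies between \<open>0\<close> and \<open>y\<close> coordinatewise. In that case the number of
  placed particles is some natural number \<open>M\<close> with \<open>vsum z + M \<le> N\<close>,
  so the multinomial moments apply after translation by \<open>z\<close>.\<close>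

lemma thinning_Wn_mean:
  assumes y: "y \<in> state_space N"
  shows "(\<Sum>x\<in>state_space N. Wn (x - z) (int N - vsum (retained i z y)) \<beta>) * thinning \<alpha> z y
      = thinning \<alpha> z y" (is ?mass)
    and "(\<Sum>x\<in>state_space N. Wn (x - z) (int N - vsum (retained i z y)) \<beta> * real_of_int (x $ m))
        * thinning \<alpha> z y
      = thinning \<alpha> z y * real_of_int (z $ m)
        + thinning \<alpha> z y * real_of_int (int N - vsum (retained i z y)) * \<beta> $ m" (is ?mean)
proof -
  have "?mass \<and> ?mean"
  proof (cases "\<forall>k. 0 \<le> z $ k \<and> z $ k \<le> y $ k")
    case False
    then have "thinning \<alpha> z y = 0" by (metis thinning_eq_0)
    then show ?thesis by simp
  next
    case True
    then have zy: "vsum z \<le> vsum y" by (intro vsum_mono) simp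
    have yN: "vsum y \<le> int N" using y by (simp add: state_space_def)
    define M where "M = nat (int N - vsum (retained i z y))"
    have M: "int N - vsum (retained i z y) = int M"
      using zy yN by (cases i) (auto simp: M_def retained_def)
    have zM: "vsum z + int M \<le> int N"
      using zy yN unfolding M[symmetric] by (cases i) (auto simp: retained_def)
    have "(\<Sum>x\<in>state_space N. Wn (x - z) (int M) \<beta>) = 1"
      using sum_Wn_shift[of z M N \<beta> "\<lambda>_. 1"] True zM by (simp add: sum_Wn)
    moreover have "(\<Sum>x\<in>state_space N. Wn (x - z) (int M) \<beta> * real_of_int (x $ m))
        = real_of_int (z $ m) + real M * \<beta> $ m"
    proof -
      have "(\<Sum>x\<in>state_space N. Wn (x - z) (int M) \<beta> * real_of_int (x $ m))
          = (\<Sum>w\<in>state_space M. Wn w (int M) \<beta> * real_of_int ((w + z) $ m))"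
        using True zM by (intro sum_Wn_shift) auto
      also have "\<dots> = (\<Sum>w\<in>state_space M. Wn w (int M) \<beta> * real_of_int (w $ m))
          + (\<Sum>w\<in>state_space M. Wn w (int M) \<beta>) * real_of_int (z $ m)"
        by (simp add: distrib_left sum.distrib sum_distrib_right)
      finally show ?thesis by (simp add: sum_Wn sum_Wn_nth)
    qed
    ultimately show ?thesis by (simp add: M algebra_simps)
  qed
  then show ?mass ?mean by auto
qed

lemma sum_Kn:
  assumes "y \<in> state_space N"
  shows "(\<Sum>x\<in>state_space N. Kn i N \<alpha> \<beta> x y) = 1"
proof -
  have "(\<Sum>x\<in>state_space N. Kn i N \<alpha> \<beta> x y)
      = (\<Sum>z\<in>state_space N. (\<Sum>x\<in>state_space N. Wn (x - z) (int N - vsum (retained i z y)) \<beta>)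
            * thinning \<alpha> z y)"
    unfolding Kn_eq by (subst sum.swap) (simp add: sum_distrib_right)
  then show ?thesis by (simp add: thinning_Wn_mean(1)[OF assms] sum_thinning[OF assms])
qed

text \<open>The mean consists of the survivors of the thinning and of the expected number of placed
  particles times \<open>\<beta> $ m\<close>. This is where \<open>weight\<close> originates: the
  expectation of \<open>vsum z\<close> is the sum of \<open>\<alpha> $ l * y $ l\<close>, while for
  type 2 the number \<open>vsum y\<close> is not random.\<close>

lemma sum_Kn_nth:
  assumes y: "y \<in> state_space N"
  shows "(\<Sum>x\<in>state_space N. Kn i N \<alpha> \<beta> x y * real_of_int (x $ m))
    = \<alpha> $ m * real_of_int (y $ m)
      + (real N - (\<Sum>l\<in>UNIV. weight i \<alpha> l * real_of_int (y $ l))) * \<beta> $ m"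
proof -
  have "(\<Sum>x\<in>state_space N. Kn i N \<alpha> \<beta> x y * real_of_int (x $ m))
      = (\<Sum>z\<in>state_space N. (\<Sum>x\<in>state_space N. Wn (x - z) (int N - vsum (retained i z y)) \<beta>
            * real_of_int (x $ m)) * thinning \<alpha> z y)"
    unfolding Kn_eq sum_distrib_right by (subst sum.swap) (simp add: mult_ac)
  also have "\<dots> = \<alpha> $ m * real_of_int (y $ m)
      + (\<Sum>z\<in>state_space N. thinning \<alpha> z y * real_of_int (int N - vsum (retained i z y))) * \<beta> $ m"
    by (simp only: thinning_Wn_mean(2)[OF y] sum.distrib sum_thinning_nth[OF y]
        sum_distrib_right[of _ _ "\<beta> $ m", symmetric])
  also have "(\<Sum>z\<in>state_space N. thinning \<alpha> z y * real_of_int (int N - vsum (retained i z y)))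
      = real N - (\<Sum>l\<in>UNIV. weight i \<alpha> l * real_of_int (y $ l))"
  proof (cases i)
    case Type1
    have "(\<Sum>z\<in>state_space N. thinning \<alpha> z y * real_of_int (vsum z))
        = (\<Sum>l\<in>UNIV. \<Sum>z\<in>state_space N. thinning \<alpha> z y * real_of_int (z $ l))"
      unfolding vsum_def of_int_sum sum_distrib_left by (rule sum.swap)
    then have "(\<Sum>z\<in>state_space N. thinning \<alpha> z y * real_of_int (vsum z))
        = (\<Sum>l\<in>UNIV. \<alpha> $ l * real_of_int (y $ l))"
      by (simp only: sum_thinning_nth[OF y])
    moreover have "(\<Sum>z\<in>state_space N. thinning \<alpha> z y * real_of_int (int N - vsum z))
        = (\<Sum>z\<in>state_space N. thinning \<alpha> z y) * real N
          - (\<Sum>z\<in>state_space N. thinning \<alpha> z y * real_of_int (vsum z))"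
      by (simp add: right_diff_distrib sum_subtractf sum_distrib_right)
    ultimately show ?thesis
      by (simp only: Type1 retained_def chain_type.case weight_def sum_thinning[OF y] mult_1)
  next
    case Type2
    then have "(\<Sum>z\<in>state_space N. thinning \<alpha> z y * real_of_int (int N - vsum (retained i z y)))
        = (\<Sum>z\<in>state_space N. thinning \<alpha> z y) * real_of_int (int N - vsum y)"
      unfolding sum_distrib_right by (simp add: retained_def)
    with Type2 show ?thesis
      by (simp add: sum_thinning[OF y] weight_def vsum_def)
  qed
  finally show ?thesis .
qed

section \<open>Detailed balance\<close>

text \<open>The part of the equilibrium flow from \<open>y\<close> to \<open>x\<close> through \<open>z\<close> in one coordinate, symmetric
  in \<open>x\<close> and \<open>y\<close>.\<close>

definition flow :: "real \<Rightarrow> real \<Rightarrow> nat \<Rightarrow> nat \<Rightarrow> nat \<Rightarrow> real" where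
  "flow a b x y z = a ^ z * b ^ (x + y - z) / (fact z * fact (x - z) * fact (y - z) * (1 - a) ^ z)"

lemma flow_commute: "flow a b x y z = flow a b y x z"
  by (simp add: flow_def add.commute mult_ac)

text \<open>The factorial of \<open>y\<close> cancels, and the binomial factor
  \<open>(1 - a) ^ (y - z)\<close> leaves only \<open>(1 - a) ^ z\<close> in the denominator; what
  remains treats \<open>x\<close> and \<open>y\<close> alike.\<close>

lemma flow_eq:
  assumes "z \<le> x" "z \<le> y" "0 < a" "a < 1"
  shows "b ^ (x - z) / fact (x - z) * W1 (int z) (int y) a * ((b / (1 - a)) ^ y / fact y)
       = flow a b x y z"
proof -
  obtain u v where x: "x = z + u" and y: "y = z + v" using assms(1,2) by (auto simp: le_iff_add)
  have W1: "W1 (int z) (int y) a = fact y / (fact z * fact v) * a ^ z * (1 - a) ^ v"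
    using assms(2) by (simp only: W1_int Bernstein_def binomial_fact) (simp add: y)
  show ?thesis
    unfolding W1 flow_def using assms(4)
    by (simp add: x y power_add power_divide field_simps)
qed

text \<open>\<open>Dn\<close> is a normalizing constant: it is the sum of the unnormalized cell
  weights \<open>\<beta> $ k / (1 - \<alpha> $ k)\<close> and of the weight \<open>r i\<close> of
  the remaining cell. All \<open>N\<close> particles together contribute the single factor
  \<open>Dn ^ N\<close>.\<close>

lemma Wn_rev_prob:
  fixes \<alpha> \<beta> :: "real ^ 'n"
  defines "r \<equiv> \<lambda>i. case i of Type1 \<Rightarrow> 1 - vsum \<beta> | Type2 \<Rightarrow> 1"
  assumes ab: "admissible \<alpha> \<beta>" and y: "y \<in> state_space N"
  shows "0 < Dn i \<alpha> \<beta>" "1 - vsum (rev_prob i \<alpha> \<beta>) = r i / Dn i \<alpha> \<beta>"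
    and "Wn y (int N) (rev_prob i \<alpha> \<beta>)
     = fact N / fact (nat (int N - vsum y)) * r i ^ nat (int N - vsum y) / Dn i \<alpha> \<beta> ^ N
       * (\<Prod>k\<in>UNIV. (\<beta> $ k / (1 - \<alpha> $ k)) ^ nat (y $ k) / fact (nat (y $ k)))"
proof -
  let ?D = "Dn i \<alpha> \<beta>" and ?t = "\<lambda>k. \<beta> $ k / (1 - \<alpha> $ k)" and ?q = "nat (int N - vsum y)"
  have pos: "0 < \<alpha> $ k" "\<alpha> $ k < 1" "0 < \<beta> $ k" for k using ab by (auto simp: admissible_def)
  show D: "0 < ?D"
    using pos by (cases i) (auto intro!: add_pos_nonneg sum_nonneg divide_nonneg_pos simp: less_imp_le)
  have "\<alpha> $ k * \<beta> $ k / (1 - \<alpha> $ k) = ?t k - \<beta> $ k" for k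
    using pos[of k] by (simp add: field_simps)
  then have "?D = r i + (\<Sum>k\<in>UNIV. ?t k)"
    by (cases i) (simp_all add: r_def sum_subtractf vsum_def)
  moreover have "vsum (rev_prob i \<alpha> \<beta>) = (\<Sum>k\<in>UNIV. ?t k) / ?D"
    by (simp add: vsum_def rev_prob_def sum_divide_distrib)
  ultimately show rest: "1 - vsum (rev_prob i \<alpha> \<beta>) = r i / ?D"
    using D by (simp add: field_simps)
  have y': "\<forall>k. 0 \<le> y $ k" "vsum y \<le> int N" using y by (simp_all add: state_space_def)
  have "int (\<Sum>k\<in>UNIV. nat (y $ k)) = vsum y" using y' by (simp add: vsum_def)
  then have N: "N = (\<Sum>k\<in>UNIV. nat (y $ k)) + ?q" using y'(2) by linarith
  have "(\<Prod>k\<in>UNIV. rev_prob i \<alpha> \<beta> $ k ^ nat (y $ k))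
      = (\<Prod>k\<in>UNIV. ?t k ^ nat (y $ k)) / ?D ^ (\<Sum>k\<in>UNIV. nat (y $ k))"
    by (simp add: rev_prob_def power_divide power_mult_distrib prod_dividef prod.distrib power_sum)
  then have "(1 - vsum (rev_prob i \<alpha> \<beta>)) ^ ?q * (\<Prod>k\<in>UNIV. rev_prob i \<alpha> \<beta> $ k ^ nat (y $ k))
      = r i ^ ?q / ?D ^ N * (\<Prod>k\<in>UNIV. ?t k ^ nat (y $ k))"
    unfolding rest by (subst N) (simp add: power_add power_divide)
  then show "Wn y (int N) (rev_prob i \<alpha> \<beta>) = fact N / fact ?q * r i ^ ?q / ?D ^ N
       * (\<Prod>k\<in>UNIV. ?t k ^ nat (y $ k) / fact (nat (y $ k)))"
    using y' by (simp add: Wn_def prod_dividef mult.assoc)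
qed

text \<open>Separates the equilibrium flow from \<open>y\<close> to \<open>x\<close> through
  \<open>z\<close> into coordinate factors and a global factor \<open>C\<close>. Both, and also the
  support condition, are symmetric in \<open>x\<close> and \<open>y\<close>, which yields
  reversibility term by term.\<close>

lemma flow_term:
  fixes \<alpha> \<beta> :: "real ^ 'n" and x y z :: "int ^ 'n"
  assumes ab: "admissible \<alpha> \<beta>"
    and xyz: "x \<in> state_space N" "y \<in> state_space N" "z \<in> state_space N"
  defines "C \<equiv> \<lambda>i. (case i of
      Type1 \<Rightarrow> fact (nat (int N - vsum z)) * (1 - vsum \<beta>) ^ nat (int N - vsum x)
        * (1 - vsum \<beta>) ^ nat (int N - vsum y)
        / (fact (nat (int N - vsum x)) * fact (nat (int N - vsum y)))
    | Type2 \<Rightarrow> (1 - vsum \<beta>) ^ nat (int N + vsum z - (vsum x + vsum y))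
        / fact (nat (int N + vsum z - (vsum x + vsum y))))"
  shows "Wn (x - z) (int N - vsum (retained i z y)) \<beta> * thinning \<alpha> z y
           * Wn y (int N) (rev_prob i \<alpha> \<beta>)
       = (if (\<forall>k. z $ k \<le> x $ k \<and> z $ k \<le> y $ k) \<and> (i = Type2 \<longrightarrow> vsum x + vsum y - vsum z \<le> int N)
          then C i * fact N / Dn i \<alpha> \<beta> ^ N
               * (\<Prod>k\<in>UNIV. flow (\<alpha> $ k) (\<beta> $ k) (nat (x $ k)) (nat (y $ k)) (nat (z $ k)))
          else 0)"
proof (cases "(\<forall>k. z $ k \<le> x $ k \<and> z $ k \<le> y $ k) \<and> (i = Type2 \<longrightarrow> vsum x + vsum y - vsum z \<le> int N)")
  case False
  have x: "vsum x \<le> int N" using xyz by (simp add: state_space_def)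
  have "Wn (x - z) (int N - vsum (retained i z y)) \<beta> * thinning \<alpha> z y = 0"
  proof (cases "\<forall>k. z $ k \<le> y $ k")
    case True
    with False x have "\<not> ((\<forall>k. 0 \<le> (x - z) $ k) \<and> vsum (x - z) \<le> int N - vsum (retained i z y))"
      by (cases i) (auto simp: retained_def vsum_diff)
    then show ?thesis by (simp only: Wn_def if_False mult_zero_left)
  next
    case False
    then have "thinning \<alpha> z y = 0" by (metis thinning_eq_0)
    then show ?thesis by simp
  qed
  with False show ?thesis by auto
next
  case True
  let ?M = "int N - vsum (retained i z y)"
  have nn: "0 \<le> x $ k" "0 \<le> y $ k" "0 \<le> z $ k" for k using xyz by (simp_all add: state_space_def)
  have le: "vsum x \<le> int N" "vsum y \<le> int N" "vsum z \<le> int N" using xyz by (simp_all add: state_space_def)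
  have zx: "z $ k \<le> x $ k" "z $ k \<le> y $ k" for k using True by auto
  have q: "vsum (x - z) \<le> ?M" using True le by (cases i) (auto simp: retained_def vsum_diff)
  have pos: "0 < \<alpha> $ k" "\<alpha> $ k < 1" "0 < \<beta> $ k" for k using ab by (auto simp: admissible_def)
  let ?c = "fact (nat ?M) / fact (nat (?M - vsum (x - z))) * (1 - vsum \<beta>) ^ nat (?M - vsum (x - z))"
  let ?p = "\<Prod>k\<in>UNIV. \<beta> $ k ^ nat (x $ k - z $ k) / fact (nat (x $ k - z $ k))"
  let ?d = "fact N / fact (nat (int N - vsum y))
        * (case i of Type1 \<Rightarrow> 1 - vsum \<beta> | Type2 \<Rightarrow> 1) ^ nat (int N - vsum y) / Dn i \<alpha> \<beta> ^ N"
  let ?r = "\<Prod>k\<in>UNIV. (\<beta> $ k / (1 - \<alpha> $ k)) ^ nat (y $ k) / fact (nat (y $ k))"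
  have Wn: "Wn (x - z) ?M \<beta> = ?c * ?p"
    using q zx by (simp add: Wn_def prod_dividef)
  have flow: "?p * thinning \<alpha> z y * ?r
      = (\<Prod>k\<in>UNIV. flow (\<alpha> $ k) (\<beta> $ k) (nat (x $ k)) (nat (y $ k)) (nat (z $ k)))"
    unfolding thinning_def prod.distrib[symmetric]
  proof (intro prod.cong refl)
    fix k
    show "\<beta> $ k ^ nat (x $ k - z $ k) / fact (nat (x $ k - z $ k)) * W1 (z $ k) (y $ k) (\<alpha> $ k)
      * ((\<beta> $ k / (1 - \<alpha> $ k)) ^ nat (y $ k) / fact (nat (y $ k)))
      = flow (\<alpha> $ k) (\<beta> $ k) (nat (x $ k)) (nat (y $ k)) (nat (z $ k))"
      using flow_eq[of "nat (z $ k)" "nat (x $ k)" "nat (y $ k)" "\<alpha> $ k" "\<beta> $ k"] nn[of k] zx[of k] pos[of k]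
      by (simp add: nat_diff_distrib nat_le_eq_zle)
  qed
  have C: "?c * ?d = C i * fact N / Dn i \<alpha> \<beta> ^ N"
  proof (cases i)
    case Type1
    have "int N - vsum z - (vsum x - vsum z) = int N - vsum x" by simp
    then show ?thesis unfolding C_def by (simp add: Type1 retained_def vsum_diff mult_ac)
  next
    case Type2
    have eq: "int N - vsum y - (vsum x - vsum z) = int N + vsum z - (vsum x + vsum y)" by simp
    show ?thesis unfolding C_def retained_def Type2 vsum_diff chain_type.case eq by simp
  qed
  have "Wn (x - z) ?M \<beta> * thinning \<alpha> z y * Wn y (int N) (rev_prob i \<alpha> \<beta>)
      = (?c * ?p) * thinning \<alpha> z y * (?d * ?r)"
    by (simp only: Wn Wn_rev_prob(3)[OF ab xyz(2)])
  also have "\<dots> = (?c * ?d) * (?p * thinning \<alpha> z y * ?r)"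
    by (simp only: mult_ac)
  finally show ?thesis
    unfolding if_P[OF True] flow C .
qed

lemma Kn_reversible:
  assumes "admissible \<alpha> \<beta>" "x \<in> state_space N" "y \<in> state_space N"
  shows "Kn i N \<alpha> \<beta> x y * Wn y (int N) (rev_prob i \<alpha> \<beta>)
       = Kn i N \<alpha> \<beta> y x * Wn x (int N) (rev_prob i \<alpha> \<beta>)"
  unfolding Kn_eq sum_distrib_right
proof (intro sum.cong refl)
  fix z :: "int ^ 'a" assume z: "z \<in> state_space N"
  show "Wn (x - z) (int N - vsum (retained i z y)) \<beta> * thinning \<alpha> z y * Wn y (int N) (rev_prob i \<alpha> \<beta>)
      = Wn (y - z) (int N - vsum (retained i z x)) \<beta> * thinning \<alpha> z x * Wn x (int N) (rev_prob i \<alpha> \<beta>)"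
    unfolding flow_term[OF assms(1,2,3) z] flow_term[OF assms(1,3,2) z]
    by (cases i) (auto simp: flow_commute add.commute mult_ac)
qed

lemma Wn_rev_prob_pos:
  assumes ab: "admissible \<alpha> \<beta>" and y: "y \<in> state_space N"
  shows "0 < Wn y (int N) (rev_prob i \<alpha> \<beta>)"
proof -
  have "0 < \<alpha> $ k" "\<alpha> $ k < 1" "0 < \<beta> $ k" "0 < 1 - vsum \<beta>" for k
    using ab by (auto simp: admissible_def)
  then show ?thesis
    unfolding Wn_rev_prob(3)[OF ab y] using Wn_rev_prob(1)[OF ab y, of i]
    by (cases i) (auto intro!: mult_pos_pos divide_pos_pos prod_pos zero_less_power)
qed

subsection \<open>Eigenvectors\<close>

lemma weight_pos: "admissible \<alpha> \<beta> \<Longrightarrow> 0 < weight i \<alpha> k"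
  by (cases i) (auto simp: weight_def admissible_def)

lemma
  fixes \<alpha> \<beta> :: "real ^ 'n" and lam :: "complex ^ 'n"
  assumes ab: "admissible \<alpha> \<beta>" and lam: "char_roots (Fmat i \<alpha> \<beta>) lam"
  shows char_root_neq_alpha: "lam $ j \<noteq> of_real (\<alpha> $ k)"
    and char_root_secular:
      "(\<Sum>k\<in>UNIV. of_real (weight i \<alpha> k * \<beta> $ k) / (lam $ j - of_real (\<alpha> $ k))) = -1"
    and char_root_real: "lam $ j \<in> \<real>"
    and char_root_inj: "inj (($) lam)"
    and char_root_neq_1: "lam $ j \<noteq> 1"
proof -
  have inj: "inj (($) \<alpha>)" and pos: "0 < weight i \<alpha> k * \<beta> $ k" and lt: "\<alpha> $ k < 1" for k
    using ab weight_pos[OF ab] by (auto simp: admissible_def inj_def)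
  note * = inj pos char_roots_prod[OF lam]
  show "lam $ j \<noteq> of_real (\<alpha> $ k)" "lam $ j \<in> \<real>" "inj (($) lam)"
    "(\<Sum>k\<in>UNIV. of_real (weight i \<alpha> k * \<beta> $ k) / (lam $ j - of_real (\<alpha> $ k))) = -1"
    using root_neq_pole[OF *] root_real[OF *] inj_roots[OF *] secular_eq[OF *] by auto
  show "lam $ j \<noteq> 1" by (rule root_neq_one[OF * lt])
qed

lemma sys_param_nth:
  "sys_param i \<alpha> lam $ k $ j = of_real (weight i \<alpha> k) * (lam $ j - 1) / (lam $ j - of_real (\<alpha> $ k))"
  by (cases i) (simp_all add: weight_def)

lemma sum_rule_iff:
  "sum_rule i \<alpha> \<beta> c \<longleftrightarrow> (\<Sum>k\<in>UNIV. of_real (weight i \<alpha> k * \<beta> $ k) / (c - of_real (\<alpha> $ k))) = -1"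
  by (cases i) (simp_all add: weight_def)

lemma sum_Kn_P1:
  assumes y: "y \<in> state_space N"
  shows "(\<Sum>x\<in>state_space N. of_real (Kn i N \<alpha> \<beta> x y) * P1 N v j x)
    = 1 - 1 / of_nat N * (\<Sum>k\<in>UNIV. v $ k $ j * (of_real (\<alpha> $ k) * of_int (y $ k)
        + (of_nat N - (\<Sum>l\<in>UNIV. of_real (weight i \<alpha> l) * of_int (y $ l))) * of_real (\<beta> $ k)))"
proof -
  let ?K = "\<lambda>x. complex_of_real (Kn i N \<alpha> \<beta> x y)"
  have "complex_of_real (\<Sum>x\<in>state_space N. Kn i N \<alpha> \<beta> x y * real_of_int (x $ k))
      = of_real (\<alpha> $ k * real_of_int (y $ k)
          + (real N - (\<Sum>l\<in>UNIV. weight i \<alpha> l * real_of_int (y $ l))) * \<beta> $ k)" for k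
    by (simp only: sum_Kn_nth[OF y])
  then have mean: "(\<Sum>x\<in>state_space N. ?K x * of_int (x $ k)) = of_real (\<alpha> $ k) * of_int (y $ k)
        + (of_nat N - (\<Sum>l\<in>UNIV. of_real (weight i \<alpha> l) * of_int (y $ l))) * of_real (\<beta> $ k)" for k
    by simp
  have "complex_of_real (\<Sum>x\<in>state_space N. Kn i N \<alpha> \<beta> x y) = 1"
    by (simp only: sum_Kn[OF y] of_real_1)
  then have mass: "(\<Sum>x\<in>state_space N. ?K x) = 1" by simp
  have "(\<Sum>x\<in>state_space N. ?K x * P1 N v j x)
      = (\<Sum>x\<in>state_space N. ?K x)
        - (\<Sum>x\<in>state_space N. 1 / of_nat N * (\<Sum>k\<in>UNIV. v $ k $ j * (?K x * of_int (x $ k))))"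
    by (simp add: P1_def right_diff_distrib sum_subtractf sum_distrib_left mult_ac)
  also have "(\<Sum>x\<in>state_space N. 1 / of_nat N * (\<Sum>k\<in>UNIV. v $ k $ j * (?K x * of_int (x $ k))))
      = 1 / of_nat N * (\<Sum>k\<in>UNIV. v $ k $ j * (\<Sum>x\<in>state_space N. ?K x * of_int (x $ k)))"
    unfolding sum_distrib_left by (rule sum.swap)
  finally show ?thesis by (simp only: mean mass)
qed

text \<open>Both sides of the eigenvalue equation are affine in \<open>y\<close>, so it is
  determined by its values at \<open>0\<close> and at the unit vectors. The secular equation makes
  the resulting conditions compatible.\<close>

lemma left_eigen_eq_P1_iff:
  assumes N: "N \<ge> 1" and c: "\<And>k. c \<noteq> of_real (\<alpha> $ k)"
    and secular: "(\<Sum>k\<in>UNIV. of_real (weight i \<alpha> k * \<beta> $ k) / (c - of_real (\<alpha> $ k))) = -1"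
  shows "left_eigen_eq i N \<alpha> \<beta> c (P1 N v j)
     \<longleftrightarrow> (\<forall>k. v $ k $ j = of_real (weight i \<alpha> k) * (c - 1) / (c - of_real (\<alpha> $ k)))"
proof
  let ?w = "\<lambda>k. complex_of_real (weight i \<alpha> k)" and ?a = "\<lambda>k. complex_of_real (\<alpha> $ k)"
    and ?b = "\<lambda>k. complex_of_real (\<beta> $ k)" and ?v = "\<lambda>k. v $ k $ j"
  have N0: "complex_of_nat N \<noteq> 0" using N by simp
  {
    assume L: "left_eigen_eq i N \<alpha> \<beta> c (P1 N v j)"
    have eq: "1 - 1 / of_nat N * (\<Sum>k\<in>UNIV. ?v k * (?a k * of_int (y $ k)
          + (of_nat N - (\<Sum>l\<in>UNIV. ?w l * of_int (y $ l))) * ?b k)) = c * P1 N v j y"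
      if "y \<in> state_space N" for y
      using bspec[OF L[unfolded left_eigen_eq_def] that] by (simp only: sum_Kn_P1[OF that])
    have "(0 :: int ^ 'a) \<in> state_space N" by (simp add: state_space_def)
    from eq[OF this] have "1 - 1 / of_nat N * (of_nat N * (\<Sum>k\<in>UNIV. ?v k * ?b k)) = c"
      by (simp add: P1_def sum_distrib_left mult_ac)
    \<comment> \<open>The state \<open>0\<close> fixes the one combination of the unknowns that
      couples all coordinates; afterwards each unit vector gives an equation for a single
      unknown.\<close>
    with N0 have vb: "(\<Sum>k\<in>UNIV. ?v k * ?b k) = 1 - c" by (simp add: algebra_simps)
    show "\<forall>k. ?v k = ?w k * (c - 1) / (c - ?a k)"
    proof
      fix m
      have delta: "(\<Sum>k\<in>UNIV. f k * of_int (axis m 1 $ k)) = f m" for f :: "'a \<Rightarrow> complex"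
        by (simp add: axis_def if_distrib cong: if_cong)
      have "axis m 1 \<in> state_space N"
        using N by (simp add: state_space_def axis_def[of m "1::int", THEN arg_cong, of "\<lambda>x. x $ _"])
      from eq[OF this] have "1 - 1 / of_nat N * (\<Sum>k\<in>UNIV. ?v k * (?a k * of_int (axis m 1 $ k)
          + (of_nat N - ?w m) * ?b k)) = c * (1 - 1 / of_nat N * ?v m)"
        by (simp only: P1_def delta)
      also have "(\<Sum>k\<in>UNIV. ?v k * (?a k * of_int (axis m 1 $ k) + (of_nat N - ?w m) * ?b k))
          = (\<Sum>k\<in>UNIV. (?v k * ?a k) * of_int (axis m 1 $ k))
            + (of_nat N - ?w m) * (\<Sum>k\<in>UNIV. ?v k * ?b k)"
        by (simp add: distrib_left sum.distrib sum_distrib_left mult_ac)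
      also have "\<dots> = ?v m * ?a m + (of_nat N - ?w m) * (1 - c)"
        by (simp only: delta vb)
      finally have "?v m * (c - ?a m) = ?w m * (c - 1)"
        using N0 by (simp add: field_simps)
      then show "?v m = ?w m * (c - 1) / (c - ?a m)"
        using c[of m] by (simp add: eq_divide_eq)
    qed
  }
  {
    assume v: "\<forall>k. ?v k = ?w k * (c - 1) / (c - ?a k)"
    \<comment> \<open>For the converse, the secular equation gives the constant term, and
      \<open>va\<close> makes the linear terms agree.\<close>
    have "(\<Sum>k\<in>UNIV. ?v k * ?b k) = (c - 1) * (\<Sum>k\<in>UNIV. of_real (weight i \<alpha> k * \<beta> $ k) / (c - ?a k))"
      unfolding sum_distrib_left by (intro sum.cong) (simp_all add: v)
    then have vb: "(\<Sum>k\<in>UNIV. ?v k * ?b k) = 1 - c" by (simp only: secular) simp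
    have va: "?v k * ?a k = c * ?v k - (c - 1) * ?w k" for k
    proof -
      have "?v k * (c - ?a k) = ?w k * (c - 1)" using c[of k] by (simp add: v)
      then show ?thesis by (simp add: algebra_simps)
    qed
    show "left_eigen_eq i N \<alpha> \<beta> c (P1 N v j)"
      unfolding left_eigen_eq_def
    proof
      fix y :: "int ^ 'a" assume y: "y \<in> state_space N"
      have split: "(\<Sum>k\<in>UNIV. ?v k * (?a k * f k + r * ?b k))
          = (\<Sum>k\<in>UNIV. (?v k * ?a k) * f k) + r * (\<Sum>k\<in>UNIV. ?v k * ?b k)" for f r
        by (simp add: distrib_left sum.distrib sum_distrib_left mult_ac)
      let ?S = "\<Sum>l\<in>UNIV. ?w l * of_int (y $ l)" and ?V = "\<Sum>l\<in>UNIV. ?v l * of_int (y $ l)"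
      have "(\<Sum>k\<in>UNIV. ?v k * (?a k * of_int (y $ k) + (of_nat N - ?S) * ?b k))
          = (\<Sum>k\<in>UNIV. (?v k * ?a k) * of_int (y $ k)) + (of_nat N - ?S) * (\<Sum>k\<in>UNIV. ?v k * ?b k)"
        by (rule split)
      also have "(\<Sum>k\<in>UNIV. (?v k * ?a k) * of_int (y $ k)) = c * ?V - (c - 1) * ?S"
        by (simp only: va left_diff_distrib sum_subtractf sum_distrib_left mult.assoc)
      also have "c * ?V - (c - 1) * ?S + (of_nat N - ?S) * (\<Sum>k\<in>UNIV. ?v k * ?b k)
          = c * ?V + of_nat N * (1 - c)"
        unfolding vb by (simp add: algebra_simps)
      finally have mean: "(\<Sum>k\<in>UNIV. ?v k * (?a k * of_int (y $ k) + (of_nat N - ?S) * ?b k))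
          = c * ?V + of_nat N * (1 - c)" .
      show "(\<Sum>x\<in>state_space N. of_real (Kn i N \<alpha> \<beta> x y) * P1 N v j x) = c * P1 N v j y"
        unfolding sum_Kn_P1[OF y] mean using N0 by (simp add: P1_def field_simps)
    qed
  }
qed

section \<open>Orthogonality and the symmetrized matrix\<close>

lemma left_eigen_eq_1: "left_eigen_eq i N \<alpha> \<beta> 1 (\<lambda>_. 1)"
proof -
  have "complex_of_real (\<Sum>x\<in>state_space N. Kn i N \<alpha> \<beta> x y) = 1" if "y \<in> state_space N" for y
    by (simp only: sum_Kn[OF that] of_real_1)
  then show ?thesis by (simp add: left_eigen_eq_def)
qed

text \<open>By detailed balance the transition operator is symmetric for the pairing weighted by the
  reversible distribution, so \<open>c\<close> and \<open>d\<close> give the same multiple of this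
  pairing. The pairing is bilinear, without conjugation, which matches the plain products in the
  orthogonality conditions.\<close>

lemma left_eigen_orthogonal:
  fixes \<alpha> \<beta> :: "real ^ 'n"
  assumes ab: "admissible \<alpha> \<beta>"
    and f: "left_eigen_eq i N \<alpha> \<beta> c f" and g: "left_eigen_eq i N \<alpha> \<beta> d g" and "c \<noteq> d"
  shows "(\<Sum>x\<in>state_space N. of_real (Wn x (int N) (rev_prob i \<alpha> \<beta>)) * f x * g x) = 0"
proof -
  let ?X = "state_space N :: (int ^ 'n) set"
  let ?W = "\<lambda>x. complex_of_real (Wn x (int N) (rev_prob i \<alpha> \<beta>))"
    and ?K = "\<lambda>x y. complex_of_real (Kn i N \<alpha> \<beta> x y)"
  have rev: "?K x y * ?W y = ?K y x * ?W x" if "x \<in> ?X" "y \<in> ?X" for x y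
    using Kn_reversible[OF ab that] by (simp flip: of_real_mult)
  have "c * (\<Sum>y\<in>?X. ?W y * f y * g y) = (\<Sum>y\<in>?X. ?W y * (c * f y) * g y)"
    by (simp add: sum_distrib_left mult_ac)
  also have "\<dots> = (\<Sum>y\<in>?X. ?W y * (\<Sum>x\<in>?X. ?K x y * f x) * g y)"
    using f by (simp add: left_eigen_eq_def)
  also have "\<dots> = (\<Sum>y\<in>?X. \<Sum>x\<in>?X. (?K x y * ?W y) * f x * g y)"
    by (simp add: sum_distrib_left sum_distrib_right mult_ac)
  also have "\<dots> = (\<Sum>y\<in>?X. \<Sum>x\<in>?X. (?K y x * ?W x) * f x * g y)"
    by (intro sum.cong refl) (simp add: rev)
  also have "\<dots> = (\<Sum>x\<in>?X. \<Sum>y\<in>?X. (?K y x * ?W x) * f x * g y)"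
    by (rule sum.swap)
  also have "\<dots> = (\<Sum>x\<in>?X. ?W x * f x * (\<Sum>y\<in>?X. ?K y x * g y))"
    by (simp add: sum_distrib_left mult_ac)
  also have "\<dots> = (\<Sum>x\<in>?X. ?W x * f x * (d * g x))"
    using g by (simp add: left_eigen_eq_def)
  also have "\<dots> = d * (\<Sum>x\<in>?X. ?W x * f x * g x)"
    by (simp add: sum_distrib_left mult_ac)
  finally show ?thesis using \<open>c \<noteq> d\<close> by simp
qed

lemma Tmat_commute:
  assumes ab: "admissible \<alpha> \<beta>" and x: "x \<in> state_space N" and y: "y \<in> state_space N"
  shows "Tmat i N \<alpha> \<beta> x y = Tmat i N \<alpha> \<beta> y x"
proof -
  let ?W = "\<lambda>x. Wn x (int N) (rev_prob i \<alpha> \<beta>)"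
  have pos: "0 < ?W x" "0 < ?W y" using Wn_rev_prob_pos[OF ab] x y by auto
  have "Kn i N \<alpha> \<beta> x y * (sqrt (?W y) * sqrt (?W y)) = Kn i N \<alpha> \<beta> y x * (sqrt (?W x) * sqrt (?W x))"
    using pos Kn_reversible[OF ab x y] by simp
  then show ?thesis
    using pos by (simp add: Tmat_def divide_simps mult_ac del: real_sqrt_mult_self)
qed

lemma Tmat_eigenvector:
  fixes \<alpha> \<beta> :: "real ^ 'n"
  assumes ab: "admissible \<alpha> \<beta>" and f: "left_eigen_eq i N \<alpha> \<beta> c f"
    and nz: "x0 \<in> state_space N" "f x0 \<noteq> 0"
  shows "eigenvector_on (state_space N) (Tmat i N \<alpha> \<beta>) c
    (\<lambda>x. of_real (sqrt (Wn x (int N) (rev_prob i \<alpha> \<beta>))) * f x)"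
  unfolding eigenvector_on_def
proof (intro conjI ballI)
  let ?W = "\<lambda>x. Wn x (int N) (rev_prob i \<alpha> \<beta>)"
  show "\<exists>x\<in>state_space N. of_real (sqrt (?W x)) * f x \<noteq> 0"
    using nz Wn_rev_prob_pos[OF ab nz(1), of i] by (intro bexI[of _ x0]) auto
  fix x :: "int ^ 'n" assume x: "x \<in> state_space N"
  \<comment> \<open>Symmetry of \<open>Tmat\<close> first exchanges \<open>x\<close> and
    \<open>y\<close>, so that the kernel appears in the orientation of the left eigenvalue
    equation.\<close>
  have "Tmat i N \<alpha> \<beta> x y * sqrt (?W y) = sqrt (?W x) * Kn i N \<alpha> \<beta> y x" if y: "y \<in> state_space N" for y
    using Wn_rev_prob_pos[OF ab y, of i] by (simp add: Tmat_commute[OF ab x y]) (simp add: Tmat_def)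
  then have eq: "complex_of_real (Tmat i N \<alpha> \<beta> x y) * (of_real (sqrt (?W y)) * f y)
      = of_real (sqrt (?W x)) * (of_real (Kn i N \<alpha> \<beta> y x) * f y)" if "y \<in> state_space N" for y
    using that by (metis mult.assoc of_real_mult)
  then have "(\<Sum>y\<in>state_space N. complex_of_real (Tmat i N \<alpha> \<beta> x y) * (of_real (sqrt (?W y)) * f y))
      = of_real (sqrt (?W x)) * (\<Sum>y\<in>state_space N. of_real (Kn i N \<alpha> \<beta> y x) * f y)"
    unfolding sum_distrib_left by (intro sum.cong refl eq)
  then show "(\<Sum>y\<in>state_space N. complex_of_real (Tmat i N \<alpha> \<beta> x y) * (of_real (sqrt (?W y)) * f y))
      = c * (of_real (sqrt (?W x)) * f x)"
    using f x by (simp add: left_eigen_eq_def mult_ac)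
qed

subsection \<open>Irrationality\<close>

text \<open>The hypothesis \<open>eq\<close> is the secular equation for \<open>P / Q\<close> after
  clearing denominators, with the \<open>m\<close>-th numerator \<open>w m + c s\<close> varying
  linearly in the polynomial variable \<open>s\<close>. Since \<open>P\<close> and \<open>Q\<close>
  are coprime and the poles distinct, \<open>Q\<close> and all the \<open>X l\<close> are pairwise
  coprime, and divisibility forces most of them to be constant.\<close>

lemma no_rational_secular_root:
  fixes a w :: "'n::finite \<Rightarrow> real" and P Q :: "real poly"
  assumes "inj a" and "\<And>k. w k \<noteq> 0" and "c \<noteq> 0" and "k \<noteq> m" and coprime: "coprime P Q"
  defines "X \<equiv> (\<lambda>l. P - smult (a l) Q)"
  assumes eq: "(\<Prod>l\<in>UNIV. X l) + (\<Sum>l\<in>UNIV. (if l = m then [:w m, c:] else [:w l:]) *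
                  (Q * (\<Prod>j\<in>UNIV - {l}. X j))) = 0"
  shows False
proof -
  let ?W = "\<lambda>l. if l = m then [:w m, c:] else [:w l:]"
  have XQ: "coprime (X l) Q" for l
  proof (rule coprimeI)
    fix d assume d: "d dvd X l" "d dvd Q"
    then have "d dvd X l + smult (a l) Q" by (intro dvd_add dvd_smult)
    with d have "d dvd P" by (simp add: X_def)
    with coprime d(2) show "is_unit d" by (auto intro: coprime_common_divisor)
  qed
  have XX: "coprime (X l) (X j)" if "l \<noteq> j" for l j
  proof (rule coprimeI)
    fix d assume d: "d dvd X l" "d dvd X j"
    then have "d dvd X j - X l" by (intro dvd_diff)
    also have "X j - X l = smult (a l - a j) Q" by (simp add: X_def smult_diff_left)
    finally have "d dvd Q" using that inj_eq[OF \<open>inj a\<close>] by (simp add: dvd_smult_iff)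
    with XQ[of l] d(1) show "is_unit d" by (auto intro: coprime_common_divisor)
  qed
  \<comment> \<open>\<open>Q\<close> divides the product of the \<open>X l\<close> although it is
    coprime to it.\<close>
  have "Q dvd (\<Sum>l\<in>UNIV. ?W l * (Q * (\<Prod>j\<in>UNIV - {l}. X j)))"
    by (intro dvd_sum) simp
  then have "Q dvd (\<Prod>l\<in>UNIV. X l)"
    using eq by (simp add: add_eq_0_iff2)
  moreover have "coprime (\<Prod>l\<in>UNIV. X l) Q" by (intro prod_coprime_left XQ)
  ultimately have Q_unit: "is_unit Q" by (simp add: coprime_absorb_right)
  \<comment> \<open>Every term but the \<open>l\<close>-th contains \<open>X l\<close>, so
    \<open>X l\<close> divides that term too. For \<open>l \<noteq> m\<close> its numerator is a
    nonzero constant, and \<open>X l\<close> is coprime to the term. For \<open>l = m\<close> the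
    numerator has a zero, and the argument does not apply.\<close>
  have X_unit: "is_unit (X l)" if "l \<noteq> m" for l
  proof -
    have "X l dvd (\<Sum>i\<in>UNIV - {l}. ?W i * (Q * (\<Prod>j\<in>UNIV - {i}. X j)))"
      by (intro dvd_sum dvd_mult dvd_prodI) auto
    moreover have "X l dvd (\<Prod>i\<in>UNIV. X i)" by (intro dvd_prodI) auto
    moreover have "d dvd r" if "d dvd p" "d dvd q" "p + q + r = 0" for d p q r :: "real poly"
      using that by (metis add_eq_0_iff dvd_add dvd_minus_iff)
    moreover have "(\<Prod>i\<in>UNIV. X i) + (\<Sum>i\<in>UNIV - {l}. ?W i * (Q * (\<Prod>j\<in>UNIV - {i}. X j)))
        + ?W l * (Q * (\<Prod>j\<in>UNIV - {l}. X j)) = 0"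
      using eq by (subst (asm) sum.remove[of UNIV l]) (simp_all add: algebra_simps)
    ultimately have dvd: "X l dvd ?W l * (Q * (\<Prod>j\<in>UNIV - {l}. X j))"
      by blast
    moreover have "is_unit (?W l)"
      using that \<open>\<And>k. w k \<noteq> 0\<close> by (simp add: is_unit_const_poly_iff dvd_field_iff)
    then have "coprime (X l) (?W l)"
      by (rule is_unit_right_imp_coprime)
    moreover have "coprime (X l) (\<Prod>j\<in>UNIV - {l}. X j)"
      by (intro prod_coprime_right XX) auto
    ultimately have "coprime (X l) (?W l * (Q * (\<Prod>j\<in>UNIV - {l}. X j)))"
      using XQ[of l] by (simp only: coprime_mult_right_iff simp_thms)
    with dvd show ?thesis by (metis coprime_common_divisor dvd_refl)
  qed
  obtain q where q: "Q = [:q:]" "q \<noteq> 0"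
    using Q_unit by (auto simp: is_unit_poly_iff dvd_field_iff)
  \<comment> \<open>The index \<open>k \<noteq> m\<close> provides one constant \<open>X k\<close>;
    as \<open>Q\<close> is constant too, all the others differ from it by constants, including
    \<open>X m\<close>.\<close>
  have "\<exists>x. X l = [:x:]" for l
  proof -
    obtain y where "X k = [:y:]" using X_unit[OF \<open>k \<noteq> m\<close>] by (auto simp: is_unit_poly_iff dvd_field_iff)
    moreover have "X l = X k + smult (a k - a l) Q" by (simp add: X_def smult_diff_left)
    ultimately show ?thesis by (simp add: q)
  qed
  then obtain x where x: "\<And>l. X l = [:x l:]" by metis
  have x_nz: "x l \<noteq> 0" if "l \<noteq> m" for l
    using X_unit[OF that] by (simp add: x is_unit_const_poly_iff dvd_field_iff)
  \<comment> \<open>With constant data the equation is affine in \<open>s\<close>; comparing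
    \<open>s = 0\<close> and \<open>s = 1\<close> isolates the coefficient of \<open>s\<close>, a
    product of nonzero numbers.\<close>
  let ?E = "\<lambda>s. (\<Prod>l\<in>UNIV. x l) + (\<Sum>l\<in>UNIV - {m}. w l * (q * (\<Prod>j\<in>UNIV - {l}. x j)))
      + (w m + s * c) * (q * (\<Prod>j\<in>UNIV - {m}. x j))"
  have "?E s = 0" for s
    using arg_cong[OF eq, of "\<lambda>p. poly p s"]
    by (simp add: poly_sum poly_prod x q(1) sum.remove[of UNIV m] algebra_simps)
  from this[of 0] this[of 1] have "c * (q * (\<Prod>j\<in>UNIV - {m}. x j)) = 0"
    by (simp add: algebra_simps)
  then show False using \<open>c \<noteq> 0\<close> q x_nz by auto
qed

section \<open>Restriction of polynomials and of admissible parameters to lines\<close>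

lemma real_polynomial_function_line:
  assumes "real_polynomial_function p"
  shows "\<exists>P. \<forall>s. p (a + s *\<^sub>R d) = poly P s"
  using assms
proof induction
  case (linear f)
  then have "f (a + s *\<^sub>R d) = poly [:f a, f d:] s" for s
    by (simp add: linear_add linear_scale bounded_linear.linear)
  then show ?case by blast
next
  case (const c)
  show ?case by (intro exI[of _ "[:c:]"]) simp
next
  case (add f g)
  then obtain P Q where "\<forall>s. f (a + s *\<^sub>R d) = poly P s" "\<forall>s. g (a + s *\<^sub>R d) = poly Q s" by blast
  then show ?case by (intro exI[of _ "P + Q"]) simp
next
  case (mult f g)
  then obtain P Q where "\<forall>s. f (a + s *\<^sub>R d) = poly P s" "\<forall>s. g (a + s *\<^sub>R d) = poly Q s" by blast
  then show ?case by (intro exI[of _ "P * Q"]) simp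
qed

lemma open_admissible: "open {(\<alpha>, \<beta>). admissible (\<alpha> :: real ^ 'n) \<beta>}"
proof -
  have "{(\<alpha>, \<beta>). admissible (\<alpha> :: real ^ 'n) \<beta>} =
      (\<Inter>k. {v. 0 < fst v $ k} \<inter> {v. fst v $ k < 1} \<inter> {v. 0 < snd v $ k} \<inter> {v. snd v $ k < 1})
      \<inter> {v. 0 < vsum (snd v)} \<inter> {v. vsum (snd v) < 1}
      \<inter> (\<Inter>k. \<Inter>l\<in>UNIV - {k}. {v. fst v $ k \<noteq> fst v $ l})"
    by (auto simp: admissible_def)
  also have "open \<dots>"
    unfolding vsum_def
    by (intro open_Int open_INT ballI open_Collect_less open_Collect_neq continuous_intros) auto
  finally show ?thesis .
qed

lemma admissible_near:
  assumes "admissible \<alpha> \<beta>"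
  shows "\<exists>e>0. \<forall>s. \<bar>s\<bar> < e \<longrightarrow> admissible (\<alpha> + s *\<^sub>R d) (\<beta> + s *\<^sub>R d')"
proof -
  have "open ((\<lambda>s. (\<alpha> + s *\<^sub>R d, \<beta> + s *\<^sub>R d')) -` {(\<alpha>, \<beta>). admissible \<alpha> \<beta>})"
    by (intro open_vimage open_admissible continuous_intros)
  then obtain e where "e > 0" "\<And>s. dist s 0 < e \<Longrightarrow> admissible (\<alpha> + s *\<^sub>R d) (\<beta> + s *\<^sub>R d')"
    using assms unfolding open_dist by (metis (mono_tags, lifting) add_0_right case_prodI
        case_prodD mem_Collect_eq scaleR_zero_left vimageE vimageI)
  then show ?thesis by (auto simp: dist_real_def)
qed

lemma secular_clear_denominators:
  fixes a w :: "'n::finite \<Rightarrow> real"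
  assumes "Q \<noteq> 0" and neq: "\<And>k. P / Q \<noteq> a k" and secular: "(\<Sum>k\<in>UNIV. w k / (P / Q - a k)) = -1"
  shows "(\<Prod>k\<in>UNIV. P - a k * Q) + (\<Sum>k\<in>UNIV. w k * (Q * (\<Prod>l\<in>UNIV - {k}. P - a l * Q))) = 0"
proof -
  have X: "P - a k * Q \<noteq> 0" for k using neq[of k] \<open>Q \<noteq> 0\<close> by (auto simp: field_simps)
  have "w k / (P / Q - a k) * (\<Prod>l\<in>UNIV. P - a l * Q) = w k * (Q * (\<Prod>l\<in>UNIV - {k}. P - a l * Q))" for k
  proof -
    have "P / Q - a k = (P - a k * Q) / Q" using \<open>Q \<noteq> 0\<close> by (simp add: field_simps)
    moreover have "(\<Prod>l\<in>UNIV. P - a l * Q) = (P - a k * Q) * (\<Prod>l\<in>UNIV - {k}. P - a l * Q)"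
      by (rule prod.remove) auto
    ultimately show ?thesis using X[of k] by simp
  qed
  then have "(\<Sum>k\<in>UNIV. w k * (Q * (\<Prod>l\<in>UNIV - {k}. P - a l * Q)))
      = (\<Sum>k\<in>UNIV. w k / (P / Q - a k)) * (\<Prod>l\<in>UNIV. P - a l * Q)"
    by (simp add: sum_distrib_right)
  then show ?thesis by (simp add: secular)
qed

text \<open>The numbering \<open>L\<close> of the roots is arbitrary and need not be continuous, so
  only polynomial identities with infinitely many zeros are used. In dimension one the single root
  is \<open>\<alpha> - w \<beta>\<close>, with \<open>w\<close> the weight, and \<open>u\<close> is
  rational; hence the bound on the dimension.\<close>

lemma sys_param_irrational:
  fixes \<alpha> \<beta> :: "real ^ 'n" and L :: "real ^ 'n \<Rightarrow> real ^ 'n \<Rightarrow> complex ^ 'n"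
  assumes ab: "admissible \<alpha> \<beta>" and n: "CARD('n) \<ge> 2"
    and L: "\<And>a b. admissible a b \<Longrightarrow> char_roots (Fmat i a b) (L a b)"
  shows "\<not> rational_on {(a, b). admissible a b} (\<lambda>(a, b). sys_param i a (L a b) $ k $ j)"
proof
  assume "rational_on {(a, b). admissible a b} (\<lambda>(a, b). sys_param i a (L a b) $ k $ j)"
  then obtain p q :: "(real ^ 'n) \<times> (real ^ 'n) \<Rightarrow> real" and v where
    p: "real_polynomial_function p" and q: "real_polynomial_function q" and v: "q v \<noteq> 0"
    and u: "\<And>a b. admissible a b \<Longrightarrow> q (a, b) \<noteq> 0 \<Longrightarrow>
        sys_param i a (L a b) $ k $ j = of_real (p (a, b) / q (a, b))"
    unfolding rational_on_def by fastforce
  have "\<exists>m. m \<noteq> k"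
  proof (rule ccontr)
    assume "\<not> ?thesis"
    then have "(UNIV :: 'n set) = {k}" by auto
    then have "CARD('n) = card {k}" by (rule arg_cong)
    with n show False by simp
  qed
  then obtain m where m: "m \<noteq> k" by blast
  have inf: "\<exists>s. 0 < s \<and> s < e \<and> poly R s \<noteq> 0" if "R \<noteq> 0" "e > 0" for R :: "real poly" and e
  proof -
    have "infinite {0<..<e}" using that(2) by simp
    then have "\<not> {0<..<e} \<subseteq> {s. poly R s = 0}"
      using poly_roots_finite[OF that(1)] finite_subset by blast
    then show ?thesis by auto
  qed
  \<comment> \<open>The denominator \<open>q\<close> may vanish at the given parameters. On the line
    towards \<open>v\<close> it is a nonzero polynomial, so it is nonzero at nearby points, which
    are still admissible.\<close>
  obtain a b where adm: "admissible a b" and qab: "q (a, b) \<noteq> 0"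
  proof -
    define d where "d = v - (\<alpha>, \<beta>)"
    obtain R where R: "\<And>s. q ((\<alpha>, \<beta>) + s *\<^sub>R d) = poly R s"
      using real_polynomial_function_line[OF q] by blast
    have "poly R 1 \<noteq> 0" using v by (simp add: d_def flip: R)
    then have "R \<noteq> 0" by auto
    moreover obtain e where "e > 0"
      and e: "\<And>s. \<bar>s\<bar> < e \<Longrightarrow> admissible (\<alpha> + s *\<^sub>R fst d) (\<beta> + s *\<^sub>R snd d)"
      using admissible_near[OF ab] by blast
    ultimately obtain s where "0 < s" "s < e" "poly R s \<noteq> 0" using inf[of R e] by blast
    moreover from this have "\<bar>s\<bar> < e" by simp
    moreover have "(\<alpha>, \<beta>) + s *\<^sub>R d = (\<alpha> + s *\<^sub>R fst d, \<beta> + s *\<^sub>R snd d)"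
      by (simp add: prod_eq_iff)
    ultimately show thesis using e[of s] R[of s] by (intro that) auto
  qed
  let ?b = "\<lambda>s. b + s *\<^sub>R axis m 1" and ?w = "weight i a"
  have line: "(a, b) + s *\<^sub>R (0, axis m 1) = (a, ?b s)" for s
    by simp
  obtain A B where A: "\<And>s. p (a, ?b s) = poly A s" and B: "\<And>s. q (a, ?b s) = poly B s"
    using real_polynomial_function_line[OF p, of "(a, b)" "(0, axis m 1)"]
      real_polynomial_function_line[OF q, of "(a, b)" "(0, axis m 1)"]
    unfolding line by blast
  obtain e where "e > 0" and "\<And>s. \<bar>s\<bar> < e \<Longrightarrow> admissible (a + s *\<^sub>R 0) (?b s)"
    using admissible_near[OF adm] by blast
  then have e: "admissible a (?b s)" if "0 < s" "s < e" for s using that by simp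
  have "poly B 0 \<noteq> 0" using qab by (simp flip: B)
  then have B0: "B \<noteq> 0" by auto
  have a: "a $ l < 1" "inj (($) a)" "b $ l \<noteq> 0" for l
    using adm by (auto simp: admissible_def inj_def less_imp_neq[THEN not_sym])
  have w: "?w l \<noteq> 0" for l using weight_pos[OF adm, of i l] by simp

  \<comment> \<open>Solving \<open>A / B = w (x - 1) / (x - a)\<close>, with \<open>w\<close> and
    \<open>a\<close> taken at index \<open>k\<close>, for the root \<open>x\<close> gives
    \<open>x = P0 / Q0\<close>.\<close>
  define P0 Q0 where "P0 = smult (a $ k) A - smult (?w k) B" and "Q0 = A - smult (?w k) B"
  have root: "poly Q0 s \<noteq> 0 \<and> (\<forall>l. poly P0 s / poly Q0 s \<noteq> a $ l)
      \<and> (\<Sum>l\<in>UNIV. ?w l * ?b s $ l / (poly P0 s / poly Q0 s - a $ l)) = -1"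
    if s: "0 < s" "s < e" "poly B s \<noteq> 0" for s
  proof -
    note adm_s = e[OF s(1,2)]
    note lam = adm_s L[OF adm_s]
    obtain x where x: "L a (?b s) $ j = of_real x"
      using char_root_real[OF lam, of j] by (auto elim: Reals_cases)
    have neq: "x \<noteq> a $ l" for l using char_root_neq_alpha[OF lam, of j l] x by simp
    have "complex_of_real (?w k * (x - 1) / (x - a $ k)) = of_real (poly A s / poly B s)"
      using u[OF adm_s] s(3) by (simp add: A B sys_param_nth x)
    then have u: "?w k * (x - 1) / (x - a $ k) = poly A s / poly B s"
      by (simp only: of_real_eq_iff)
    then have AB: "?w k * (x - 1) * poly B s = (x - a $ k) * poly A s"
      using neq[of k] s(3) by (simp add: field_simps)
    then have PQ: "x * poly Q0 s = poly P0 s"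
      by (simp add: P0_def Q0_def algebra_simps)
    \<comment> \<open>Since \<open>a $ k \<noteq> 1\<close>, this Moebius map is invertible, and
      \<open>Q0\<close> cannot vanish where \<open>B\<close> does not.\<close>
    have "(x - a $ k) * poly Q0 s = - (?w k * (1 - a $ k) * poly B s)"
      using AB by (simp add: Q0_def algebra_simps)
    then have Q: "poly Q0 s \<noteq> 0" using w[of k] a(1)[of k] s(3) by auto
    then have x_eq: "poly P0 s / poly Q0 s = x" by (simp flip: PQ)
    have "complex_of_real (\<Sum>l\<in>UNIV. ?w l * ?b s $ l / (x - a $ l)) = of_real (-1)"
      using char_root_secular[OF lam, of j] by (simp add: x)
    then have "(\<Sum>l\<in>UNIV. ?w l * ?b s $ l / (x - a $ l)) = -1"
      by (simp only: of_real_eq_iff)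
    with Q neq show ?thesis by (simp add: x_eq)
  qed
  obtain s0 where "0 < s0" "s0 < e" "poly B s0 \<noteq> 0" using inf[OF B0 \<open>e > 0\<close>] by blast
  from root[OF this] have "gcd P0 Q0 \<noteq> 0" by auto
  from gcd_coprime_exists[OF this]
  obtain P Q G where P: "P0 = P * G" and Q: "Q0 = Q * G" and PQ: "coprime P Q"
    by blast
  define W where "W = (\<lambda>l. if l = m then [:?w m * b $ m, ?w m:] else [:?w l * b $ l:])"
  define E where "E = (\<Prod>l\<in>UNIV. P - smult (a $ l) Q)
      + (\<Sum>l\<in>UNIV. W l * (Q * (\<Prod>j\<in>UNIV - {l}. P - smult (a $ j) Q)))"
  \<comment> \<open>The secular equation holds at all small positive \<open>s\<close> with
    \<open>B\<close> nonzero, which are infinitely many zeros of \<open>E\<close>.\<close>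
  have "E = 0"
  proof (rule ccontr)
    assume "E \<noteq> 0"
    then have "E * B \<noteq> 0" using B0 by simp
    then obtain s where s: "0 < s" "s < e" "poly E s \<noteq> 0" "poly B s \<noteq> 0"
      using inf[of "E * B" e] \<open>e > 0\<close> by auto
    have "poly P0 s = poly P s * poly G s" "poly Q0 s = poly Q s * poly G s"
      by (simp_all only: P Q poly_mult)
    moreover note r = root[OF s(1,2,4)]
    ultimately have Qs: "poly Q s \<noteq> 0" and eq: "poly P0 s / poly Q0 s = poly P s / poly Q s"
      by auto
    have "poly (W l) s = ?w l * ?b s $ l" for l
      by (auto simp: W_def axis_def algebra_simps)
    then have "poly E s = 0"
      using secular_clear_denominators[OF Qs, of "poly P s" "($) a" "\<lambda>l. ?w l * ?b s $ l"] r
      by (simp add: E_def poly_sum poly_prod eq)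
    with s(3) show False by simp
  qed
  show False
  proof (rule no_rational_secular_root[where w = "\<lambda>l. ?w l * b $ l", OF a(2) _ w[of m] m[symmetric] PQ])
    show "?w l * b $ l \<noteq> 0" for l using w a(3) by simp
    show "(\<Prod>l\<in>UNIV. P - smult (a $ l) Q)
        + (\<Sum>l\<in>UNIV. (if l = m then [:?w m * b $ m, ?w m:] else [:?w l * b $ l:])
            * (Q * (\<Prod>j\<in>UNIV - {l}. P - smult (a $ j) Q))) = 0"
      using \<open>E = 0\<close> unfolding E_def W_def .
  qed
qed

section \<open>Identification of the parameters, sum rules, orthogonality and irrationality
  combined\<close>

theorem theorem3p2:
  fixes i :: chain_type and N :: nat
    and \<alpha> \<beta> :: "real ^ 'n" and lam :: "complex ^ 'n"
  assumes "N \<ge> 1"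
    and "admissible \<alpha> \<beta>"
    and "char_roots (Fmat i \<alpha> \<beta>) lam"
  defines "u \<equiv> sys_param i \<alpha> lam"
    and "W \<equiv> (\<lambda>x. Wn x (int N) (rev_prob i \<alpha> \<beta>))"
  shows
    "(\<forall>j. lam $ j \<in> \<real>) \<and> (\<forall>k j. lam $ j \<noteq> of_real (\<alpha> $ k)) \<and>
     (\<forall>v j. left_eigen_eq i N \<alpha> \<beta> (lam $ j) (P1 N v j) \<longleftrightarrow> (\<forall>k. v $ k $ j = u $ k $ j)) \<and>
     (\<forall>j. (\<Sum>k\<in>UNIV. of_real (\<beta> $ k) * u $ k $ j) = 1 - lam $ j) \<and>
     (\<forall>j. sum_rule i \<alpha> \<beta> (lam $ j)) \<and>
     (\<forall>x\<in>state_space N. \<forall>y\<in>state_space N. Tmat i N \<alpha> \<beta> x y = Tmat i N \<alpha> \<beta> y x) \<and>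
     (\<forall>j. eigenvector_on (state_space N) (Tmat i N \<alpha> \<beta>) (lam $ j)
            (\<lambda>x. of_real (sqrt (W x)) * P1 N u j x)) \<and>
     (\<forall>j. (\<Sum>x\<in>state_space N. of_real (W x) * P1 N u j x) = 0) \<and>
     (\<forall>j l. j \<noteq> l \<longrightarrow> (\<Sum>x\<in>state_space N. of_real (W x) * P1 N u j x * P1 N u l x) = 0) \<and>
     (CARD('n) \<ge> 2 \<longrightarrow>
       (\<forall>L :: real ^ 'n \<Rightarrow> real ^ 'n \<Rightarrow> complex ^ 'n.
          (\<forall>a b. admissible a b \<longrightarrow> char_roots (Fmat i a b) (L a b)) \<longrightarrow>
          (\<forall>k j. \<not> rational_on {(a, b). admissible a b}
                      (\<lambda>(a, b). sys_param i a (L a b) $ k $ j))))"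
proof -
  note ab = assms(2) and lam = assms(2,3)
  have iff: "left_eigen_eq i N \<alpha> \<beta> (lam $ j) (P1 N v j) \<longleftrightarrow> (\<forall>k. v $ k $ j = u $ k $ j)" for v j
    unfolding u_def sys_param_nth
    by (intro left_eigen_eq_P1_iff assms(1) char_root_neq_alpha[OF lam] char_root_secular[OF lam])
  have eigen: "left_eigen_eq i N \<alpha> \<beta> (lam $ j) (P1 N u j)" for j by (simp add: iff)
  have rule: "(\<Sum>k\<in>UNIV. of_real (\<beta> $ k) * u $ k $ j) = 1 - lam $ j" for j
  proof -
    have "(\<Sum>k\<in>UNIV. of_real (\<beta> $ k) * u $ k $ j) = (lam $ j - 1) *
        (\<Sum>k\<in>UNIV. of_real (weight i \<alpha> k * \<beta> $ k) / (lam $ j - of_real (\<alpha> $ k)))"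
      unfolding sum_distrib_left by (intro sum.cong) (simp_all add: u_def sys_param_nth)
    then show ?thesis by (simp only: char_root_secular[OF lam]) simp
  qed
  have vec: "eigenvector_on (state_space N) (Tmat i N \<alpha> \<beta>) (lam $ j)
            (\<lambda>x. of_real (sqrt (W x)) * P1 N u j x)" for j
    \<comment> \<open>The vector is nonzero because \<open>P1\<close> takes the value
      \<open>1\<close> at the state \<open>0\<close>.\<close>
    unfolding W_def by (rule Tmat_eigenvector[OF ab eigen, of 0]) (simp_all add: state_space_def P1_def)
  have orth1: "(\<Sum>x\<in>state_space N. of_real (W x) * P1 N u j x) = 0" for j
    using left_eigen_orthogonal[OF ab eigen left_eigen_eq_1 char_root_neq_1[OF lam]]
    by (simp add: W_def)
  have orth: "(\<Sum>x\<in>state_space N. of_real (W x) * P1 N u j x * P1 N u l x) = 0" if "j \<noteq> l" for j l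
  proof -
    have "lam $ j \<noteq> lam $ l" using char_root_inj[OF lam] that by (auto dest: injD)
    then show ?thesis unfolding W_def by (rule left_eigen_orthogonal[OF ab eigen eigen])
  qed
  show ?thesis
  proof (intro conjI allI impI ballI)
    fix L :: "real ^ 'n \<Rightarrow> real ^ 'n \<Rightarrow> complex ^ 'n" and k j
    assume "CARD('n) \<ge> 2" "\<forall>a b. admissible a b \<longrightarrow> char_roots (Fmat i a b) (L a b)"
    then show "\<not> rational_on {(a, b). admissible a b} (\<lambda>(a, b). sys_param i a (L a b) $ k $ j)"
      by (intro sys_param_irrational[OF ab]) blast+
  next
    show "sum_rule i \<alpha> \<beta> (lam $ j)" for j
      unfolding sum_rule_iff by (rule char_root_secular[OF lam])
  qed (fact iff rule vec orth1 char_root_real[OF lam] char_root_neq_alpha[OF lam]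
        | rule orth Tmat_commute[OF ab], assumption+)+
qed

end
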